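(* Let $Y$ be a quasi-malleable nonsingular real algebraic variety. Let $X$ be a real algebraic variety (possibly singular), and $D$ an arbitrary contractible subset of $X$. Then every continuous map from $D$ to $Y$ can be approximated in the compact-open topology by regular maps from $X$ to $Y$.
   Context: A real algebraic variety is a ringed space with structure sheaf of $\mathbb{R}$-algebras of $\mathbb{R}$-valued functions which is isomorphic to a Zariski locally closed subset of some real projective space $\mathbb{P}^n(\mathbb{R})$, with the Zariski topology and the sheaf of regular functions; each such variety is affine, i.e. isomorphic to an algebraic subset of some $\mathbb{R}^n$. Morphisms are called regular maps: for algebraic sets $X\subset\mathbb{R}^n$, $Y\subset\mathbb{R}^p$ and $U\subset X$ Zariski open, a function $U\to\mathbb{R}$ is regular iff it equals $P/Q$ on $U$ for polynomials $P,Q$ with $Q$ nowhere zero on $U$, and a map $U\to Y$ is regular iff its components are. Unless stated otherwise, topological notions (continuity, contractibility, ...) refer to the Euclidean topology. Smooth means $\mathcal{C}^\infty$. $\mathcal{C}(D,Y)$ is the space of continuous maps $D\to Y$ with the compact-open topology. A continuous map $f:D\to Y$ can be approximated in the compact-open topology by regular maps from $X$ to $Y$ if for every open neighborhood $\mathcal{U}\subset\mathcal{C}(D,Y)$ of $f$ there is a regular map $g:X\to Y$ with $g|_D\in\mathcal{U}$. Vector bundles are real; algebraic vector bundles are those algebraically isomorphic to algebraic subbundles of product bundles $Y\times\mathbb{R}^n$ (Bochnak–Coste–Roy). For a vector bundle $p:E\to Y$, $E_y=p^{-1}(y)$ and $0_y$ is the zero vector of $E_y$. $\Omega(Y)$ denotes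 the collection of all relatively compact open subsets of $Y$. A quasi-spray $(E,p,\{s_V\},\{\tau_V\})$ for $Y$ consists of an algebraic vector bundle $p:E\to Y$ and two collections indexed by $V\in\Omega(Y)$, where $s_V:E\to Y$ is a regular map and $\tau_V:V\to E$ is a smooth map such that $s_V(\tau_V(y))=y$ and $p(\tau_V(y))=y$ for all $y\in V$. It is dominating if for every $V\in\Omega(Y)$ and every $y\in V$ the map $E_y\to Y$, $v\mapsto s_V(v+\tau_V(y))$ is a submersion at $0_y$. $Y$ is quasi-malleable if it admits a dominating quasi-spray. *)

theory Defs
  imports "HOL-Analysis.Analysis"
begin

section \<open>Real algebraic varieties and regular maps\<close>

text \<open>
  Every real algebraic variety is affine, that is, isomorphic to an algebraic subset of some
  Euclidean space. Varieties are therefore represented by algebraic subsets of a type of class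
  \<^class>\<open>euclidean_space\<close>, and \<^const>\<open>real_polynomial_function\<close> is the notion of
  polynomial. No irreducibility, dimension or smoothness is built in.
\<close>

definition algebraic_set :: "'a::euclidean_space set \<Rightarrow> bool" where
  "algebraic_set X \<longleftrightarrow>
     (\<exists>\<P>. (\<forall>P\<in>\<P>. real_polynomial_function P) \<and> X = {x. \<forall>P\<in>\<P>. P x = 0})"

definition zariski_open_in :: "'a::euclidean_space set \<Rightarrow> 'a set \<Rightarrow> bool" where
  "zariski_open_in X U \<longleftrightarrow> (\<exists>Z. algebraic_set Z \<and> U = X - Z)"

text \<open>
  The next three notions are only meant for Zariski open subsets of algebraic sets.
\<close>

definition regular_function :: "'a::euclidean_space set \<Rightarrow> ('a \<Rightarrow> real) \<Rightarrow> bool" where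
  "regular_function U f \<longleftrightarrow>
     (\<exists>P Q. real_polynomial_function P \<and> real_polynomial_function Q \<and>
            (\<forall>x\<in>U. Q x \<noteq> 0 \<and> f x = P x / Q x))"

definition regular_map ::
  "'a::euclidean_space set \<Rightarrow> 'b::euclidean_space set \<Rightarrow> ('a \<Rightarrow> 'b) \<Rightarrow> bool" where
  "regular_map U W f \<longleftrightarrow> f \<in> U \<rightarrow> W \<and> (\<forall>b\<in>Basis. regular_function U (\<lambda>x. f x \<bullet> b))"

definition biregular_map ::
  "'a::euclidean_space set \<Rightarrow> 'b::euclidean_space set \<Rightarrow> ('a \<Rightarrow> 'b) \<Rightarrow> bool" where
  "biregular_map U W f \<longleftrightarrow> regular_map U W f \<and>
     (\<exists>g. regular_map W U g \<and> (\<forall>x\<in>U. g (f x) = x) \<and> (\<forall>y\<in>W. f (g y) = y))"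

definition gradient :: "('a::euclidean_space \<Rightarrow> real) \<Rightarrow> 'a \<Rightarrow> 'a" where
  "gradient P x = (\<Sum>b\<in>Basis. frechet_derivative P (at x) b *\<^sub>R b)"

text \<open>
  A point is nonsingular if, on a Zariski neighbourhood of it, the variety is the zero set of
  polynomials from its ideal whose gradients at the point are linearly independent (equivalently,
  the local ring is regular). A nonsingular variety need not be equidimensional: the number of
  polynomials may depend on the point.
\<close>

definition nonsingular_at :: "'a::euclidean_space set \<Rightarrow> 'a \<Rightarrow> bool" where
  "nonsingular_at Y y \<longleftrightarrow>
     (\<exists>\<P> U. zariski_open_in UNIV U \<and> y \<in> U \<and>
        (\<forall>P\<in>\<P>. real_polynomial_function P \<and> (\<forall>z\<in>Y. P z = 0)) \<and>
        Y \<inter> U = {z\<in>U. \<forall>P\<in>\<P>. P z = 0} \<and>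
        inj_on (\<lambda>P. gradient P y) \<P> \<and> independent ((\<lambda>P. gradient P y) ` \<P>))"

definition nonsingular :: "'a::euclidean_space set \<Rightarrow> bool" where
  "nonsingular Y \<longleftrightarrow> (\<forall>y\<in>Y. nonsingular_at Y y)"

text \<open>
  The Zariski tangent space. At nonsingular points it is the tangent space of the underlying
  embedded manifold, and it is only used there.
\<close>

definition tangent_space :: "'a::euclidean_space set \<Rightarrow> 'a \<Rightarrow> 'a set" where
  "tangent_space Y y =
     {v. \<forall>P. real_polynomial_function P \<and> (\<forall>z\<in>Y. P z = 0) \<longrightarrow> gradient P y \<bullet> v = 0}"


section \<open>Smooth maps and submersions\<close>

text \<open>
  \<open>Ck_on k f U\<close>: \<open>f\<close> is \<open>k\<close> times continuously differentiable on the open set \<open>U\<close>. Since the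
  domain is finite-dimensional, it suffices to control the directional derivatives.
\<close>

primrec Ck_on ::
  "nat \<Rightarrow> ('a::euclidean_space \<Rightarrow> 'b::euclidean_space) \<Rightarrow> 'a set \<Rightarrow> bool" where
  "Ck_on 0 f U \<longleftrightarrow> continuous_on U f"
| "Ck_on (Suc k) f U \<longleftrightarrow>
     (\<exists>f'. (\<forall>x\<in>U. (f has_derivative f' x) (at x)) \<and> (\<forall>v. Ck_on k (\<lambda>x. f' x v) U))"

text \<open>
  Smoothness of a map on a subset of a Euclidean space, by local smooth extensions. On open
  subsets of an embedded submanifold this is the usual notion.
\<close>

definition smooth_map ::
  "'a::euclidean_space set \<Rightarrow> 'b::euclidean_space set \<Rightarrow> ('a \<Rightarrow> 'b) \<Rightarrow> bool" where
  "smooth_map V W f \<longleftrightarrow> f \<in> V \<rightarrow> W \<and>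
     (\<forall>x\<in>V. \<exists>U g. open U \<and> x \<in> U \<and> (\<forall>k. Ck_on k g U) \<and> (\<forall>z\<in>V \<inter> U. g z = f z))"

text \<open>
  The derivative within \<open>A\<close> is unique on the tangent space of \<open>A\<close> at \<open>a\<close> when \<open>A\<close> is nonsingular
  at \<open>a\<close>; its restriction to that space is the differential of \<open>f\<close>.
\<close>

definition submersion_at ::
  "'a::euclidean_space set \<Rightarrow> 'b::euclidean_space set \<Rightarrow> ('a \<Rightarrow> 'b) \<Rightarrow> 'a \<Rightarrow> bool" where
  "submersion_at A B f a \<longleftrightarrow>
     (\<exists>f'. (f has_derivative f') (at a within A) \<and>
           f' ` tangent_space A a = tangent_space B (f a))"


section \<open>Algebraic vector bundles\<close>

text \<open>
  An algebraic subbundle of the product bundle \<open>Y \<times> 'f\<close>: an algebraic subset whose fibres are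
  linear subspaces and which, Zariski locally on \<open>Y\<close>, is algebraically isomorphic to a product
  bundle. The fibre of the latter is a subspace \<open>K\<close> of \<open>'f\<close>; subspaces of \<open>'f\<close> realise all the
  ranks that can occur.
\<close>

definition algebraic_subbundle ::
  "'b::euclidean_space set \<Rightarrow> ('b \<times> 'f::euclidean_space) set \<Rightarrow> bool" where
  "algebraic_subbundle Y F \<longleftrightarrow>
     algebraic_set F \<and> fst ` F \<subseteq> Y \<and>
     (\<forall>y\<in>Y. subspace {v. (y, v) \<in> F}) \<and>
     (\<forall>y\<in>Y. \<exists>U (K :: 'f set) h. zariski_open_in Y U \<and> y \<in> U \<and> subspace K \<and>
        biregular_map (F \<inter> (U \<times> UNIV)) (U \<times> K) h \<and>
        (\<forall>w\<in>F \<inter> (U \<times> UNIV). fst (h w) = fst w) \<and>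
        (\<forall>z\<in>U. \<forall>u v. (z, u) \<in> F \<and> (z, v) \<in> F \<longrightarrow>
           snd (h (z, u + v)) = snd (h (z, u)) + snd (h (z, v))) \<and>
        (\<forall>z\<in>U. \<forall>c u. (z, u) \<in> F \<longrightarrow> snd (h (z, c *\<^sub>R u)) = c *\<^sub>R snd (h (z, u))))"

text \<open>
  The data of a vector bundle: total space, projection and the fibrewise linear structure. The
  operations are only relevant on vectors that lie in the same fibre.
\<close>

record ('b, 'e) vbundle =
  vb_total :: "'e set"
  vb_proj :: "'e \<Rightarrow> 'b"
  vb_zero :: "'b \<Rightarrow> 'e"
  vb_add :: "'e \<Rightarrow> 'e \<Rightarrow> 'e"
  vb_scale :: "real \<Rightarrow> 'e \<Rightarrow> 'e"

definition vb_fibre :: "('b, 'e) vbundle \<Rightarrow> 'b \<Rightarrow> 'e set" where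
  "vb_fibre E y = {u \<in> vb_total E. vb_proj E u = y}"

text \<open>
  Algebraic vector bundles are those algebraically isomorphic to an algebraic subbundle of a
  product bundle. The vector space axioms on the fibres follow from the existence of the fibrewise
  bijection \<open>\<phi>\<close> that respects the operations. The argument of type \<open>'f itself\<close> fixes the Euclidean
  space that is the fibre of the ambient product bundle.
\<close>

definition algebraic_vector_bundle ::
  "'f::euclidean_space itself \<Rightarrow> 'b::euclidean_space set \<Rightarrow> ('b, 'e::euclidean_space) vbundle \<Rightarrow> bool"
where
  "algebraic_vector_bundle _ Y E \<longleftrightarrow>
     algebraic_set (vb_total E) \<and> regular_map (vb_total E) Y (vb_proj E) \<and>
     (\<forall>y\<in>Y. vb_zero E y \<in> vb_fibre E y \<and>
        (\<forall>u\<in>vb_fibre E y. \<forall>v\<in>vb_fibre E y. vb_add E u v \<in> vb_fibre E y) \<and>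
        (\<forall>c. \<forall>u\<in>vb_fibre E y. vb_scale E c u \<in> vb_fibre E y)) \<and>
     (\<exists>(F :: ('b \<times> 'f) set) \<phi>. algebraic_subbundle Y F \<and>
        biregular_map (vb_total E) F \<phi> \<and>
        (\<forall>u\<in>vb_total E. fst (\<phi> u) = vb_proj E u) \<and>
        (\<forall>y\<in>Y. snd (\<phi> (vb_zero E y)) = 0 \<and>
           (\<forall>u\<in>vb_fibre E y. \<forall>v\<in>vb_fibre E y.
              snd (\<phi> (vb_add E u v)) = snd (\<phi> u) + snd (\<phi> v)) \<and>
           (\<forall>c. \<forall>u\<in>vb_fibre E y. snd (\<phi> (vb_scale E c u)) = c *\<^sub>R snd (\<phi> u))))"


section \<open>Quasi-sprays\<close>

definition relatively_compact_open :: "'b::euclidean_space set \<Rightarrow> 'b set set" where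
  "relatively_compact_open Y = {V. openin (top_of_set Y) V \<and> compact (Y \<inter> closure V)}"

definition quasi_spray ::
  "'f::euclidean_space itself \<Rightarrow> 'b::euclidean_space set \<Rightarrow> ('b, 'e::euclidean_space) vbundle \<Rightarrow>
     ('b set \<Rightarrow> 'e \<Rightarrow> 'b) \<Rightarrow> ('b set \<Rightarrow> 'b \<Rightarrow> 'e) \<Rightarrow> bool" where
  "quasi_spray T Y E s \<tau> \<longleftrightarrow>
     algebraic_vector_bundle T Y E \<and>
     (\<forall>V\<in>relatively_compact_open Y.
        regular_map (vb_total E) Y (s V) \<and> smooth_map V (vb_total E) (\<tau> V) \<and>
        (\<forall>y\<in>V. s V (\<tau> V y) = y \<and> vb_proj E (\<tau> V y) = y))"

definition dominating ::
  "'b::euclidean_space set \<Rightarrow> ('b, 'e::euclidean_space) vbundle \<Rightarrow>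
     ('b set \<Rightarrow> 'e \<Rightarrow> 'b) \<Rightarrow> ('b set \<Rightarrow> 'b \<Rightarrow> 'e) \<Rightarrow> bool" where
  "dominating Y E s \<tau> \<longleftrightarrow>
     (\<forall>V\<in>relatively_compact_open Y. \<forall>y\<in>V.
        submersion_at (vb_fibre E y) Y (\<lambda>v. s V (vb_add E v (\<tau> V y))) (vb_zero E y))"

text \<open>
  Quasi-malleability asks for a dominating quasi-spray whose bundle may live in Euclidean spaces of
  any dimension. HOL cannot quantify over the types \<open>'e\<close> (ambient space of the total space) and
  \<open>'f\<close> inside a formula, so they are parameters. In a theorem that assumes
  \<open>quasi_malleable TYPE('e) TYPE('f) Y\<close> with type variables \<open>'e\<close> and \<open>'f\<close> that occur nowhere else,
  they are universally quantified from outside, which is the same as an existential quantifier in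
  the assumption.
\<close>

definition quasi_malleable ::
  "'e::euclidean_space itself \<Rightarrow> 'f::euclidean_space itself \<Rightarrow> 'b::euclidean_space set \<Rightarrow> bool" where
  "quasi_malleable _ T Y \<longleftrightarrow>
     (\<exists>(E :: ('b, 'e) vbundle) s \<tau>. quasi_spray T Y E s \<tau> \<and> dominating Y E s \<tau>)"


section \<open>Approximation in the compact-open topology\<close>

text \<open>
  Maps on \<open>D\<close> are represented by functions that are \<^const>\<open>undefined\<close> outside \<open>D\<close>, so that equality
  of elements of \<open>continuous_maps D Y\<close> is equality on \<open>D\<close>.
\<close>

definition continuous_maps ::
  "'a::topological_space set \<Rightarrow> 'b::topological_space set \<Rightarrow> ('a \<Rightarrow> 'b) set" where
  "continuous_maps D Y = {f \<in> D \<rightarrow>\<^sub>E Y. continuous_on D f}"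

definition compact_open_topology ::
  "'a::topological_space set \<Rightarrow> 'b::topological_space set \<Rightarrow> ('a \<Rightarrow> 'b) topology" where
  "compact_open_topology D Y = topology_generated_by
     {{f \<in> continuous_maps D Y. f ` K \<subseteq> W} | K W.
        compact K \<and> K \<subseteq> D \<and> openin (top_of_set Y) W}"

definition approximable_by_regular_maps ::
  "'a::euclidean_space set \<Rightarrow> 'a set \<Rightarrow> 'b::euclidean_space set \<Rightarrow> ('a \<Rightarrow> 'b) \<Rightarrow> bool" where
  "approximable_by_regular_maps X D Y f \<longleftrightarrow>
     (\<forall>\<U>. openin (compact_open_topology D Y) \<U> \<and> f \<in> \<U> \<longrightarrow>
        (\<exists>g. regular_map X Y g \<and> restrict g D \<in> \<U>))"

lemma topspace_compact_open_topology: "topspace (compact_open_topology D Y) = continuous_maps D Y"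
proof -
  have "continuous_maps D Y \<in> {{f \<in> continuous_maps D Y. f ` K \<subseteq> W} | K W.
        compact K \<and> K \<subseteq> D \<and> openin (top_of_set Y) W}"
    by (rule CollectI, rule exI[of _ "{}"], rule exI[of _ "{}"]) simp
  then show ?thesis
    unfolding compact_open_topology_def topology_generated_by_topspace by blast
qed

end

theory Submission
  imports Defs
begin

text \<open>
  The maps that can be approximated on a compact set \<open>K\<close> are propagated along homotopies. A
  continuous map on a contractible set is homotopic to a constant map, which is regular, so it
  suffices to have a threshold \<open>\<epsilon>\<close>, uniform along the homotopy, with this property: if some
  regular map \<open>g\<close> from \<open>X\<close> to \<open>Y\<close> is within \<open>\<epsilon>\<close> of \<open>f\<close> on \<open>K\<close>, then regular maps come
  arbitrarily near to \<open>f\<close> on \<open>K\<close> (\<open>quasi_malleable_self_improving_approximation\<close>). The homotopy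
  is then cut into steps shorter than \<open>\<epsilon>\<close> (\<open>homotopic_to_regular_imp_approximable\<close>).

  The threshold comes from the spray. Transported to an algebraic subbundle \<open>F\<close> of a product
  bundle, the spray is a regular map \<open>S\<close> from \<open>F\<close> to \<open>Y\<close> with a continuous section \<open>t\<close> such that
  \<open>S (y, t y) = y\<close> and such that the derivative of \<open>S\<close> along the fibre at \<open>t y\<close> covers the
  tangent space of \<open>Y\<close> at \<open>y\<close> (\<open>quasi_spray_on_subbundle\<close>). One would like to solve
  \<open>S (g x, v x) = f x\<close> for a continuous section \<open>v\<close> near \<open>t \<circ> g\<close> and replace \<open>v\<close> by a regular
  section. Solving the equation, which would take an implicit function theorem with parameters,
  is avoided by an iteration: a single gradient step towards \<open>f x\<close> reduces the distance by a
  fixed factor (\<open>spray_gradient_step\<close>), the section that it uses is replaced by a regular one,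
  and the procedure starts again from the regular map obtained. The contraction factor is
  uniform because limits of secants of \<open>Y\<close> lie in the Zariski tangent space
  (\<open>secant_limit_in_tangent_space\<close>), which is covered by the derivative of \<open>S\<close>.

  Regular sections are plentiful because over a compact subset of \<open>Y\<close> the fibres of \<open>F\<close> are
  spanned by finitely many polynomial sections defined over all of \<open>Y\<close>
  (\<open>algebraic_subbundle_compact_sections\<close>). Approximating coefficients by polynomials then
  approximates a continuous section over \<open>K\<close> by one that is regular on all of \<open>X\<close>
  (\<open>regular_sections_dense\<close>).
\<close>

section \<open>Regular functions and regular maps\<close>

lemma regular_function_subset:
  "regular_function U f \<Longrightarrow> V \<subseteq> U \<Longrightarrow> regular_function V f"
  unfolding regular_function_def by blast

lemma regular_function_cong:
  assumes "\<And>x. x \<in> U \<Longrightarrow> f x = g x"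
  shows "regular_function U f \<longleftrightarrow> regular_function U g"
  using assms unfolding regular_function_def by metis

lemma regular_function_polynomial:
  assumes "real_polynomial_function P"
  shows "regular_function U P"
  unfolding regular_function_def
  by (rule exI[of _ P], rule exI[of _ "\<lambda>_. 1"]) (use assms in auto)

lemma regular_function_add:
  assumes "regular_function U f" "regular_function U g"
  shows "regular_function U (\<lambda>x. f x + g x)"
proof -
  obtain P Q where f: "real_polynomial_function P" "real_polynomial_function Q"
    "\<forall>x\<in>U. Q x \<noteq> 0 \<and> f x = P x / Q x"
    using assms unfolding regular_function_def by blast
  obtain P' Q' where g: "real_polynomial_function P'" "real_polynomial_function Q'"
    "\<forall>x\<in>U. Q' x \<noteq> 0 \<and> g x = P' x / Q' x"
    using assms unfolding regular_function_def by blast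
  show ?thesis
    unfolding regular_function_def
    by (rule exI[of _ "\<lambda>x. P x * Q' x + P' x * Q x"], rule exI[of _ "\<lambda>x. Q x * Q' x"])
      (use f g in \<open>auto simp: add_frac_eq\<close>)
qed

lemma regular_function_mult:
  assumes "regular_function U f" "regular_function U g"
  shows "regular_function U (\<lambda>x. f x * g x)"
proof -
  obtain P Q where f: "real_polynomial_function P" "real_polynomial_function Q"
    "\<forall>x\<in>U. Q x \<noteq> 0 \<and> f x = P x / Q x"
    using assms unfolding regular_function_def by blast
  obtain P' Q' where g: "real_polynomial_function P'" "real_polynomial_function Q'"
    "\<forall>x\<in>U. Q' x \<noteq> 0 \<and> g x = P' x / Q' x"
    using assms unfolding regular_function_def by blast
  show ?thesis
    unfolding regular_function_def
    by (rule exI[of _ "\<lambda>x. P x * P' x"], rule exI[of _ "\<lambda>x. Q x * Q' x"])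
      (use f g in auto)
qed

lemma regular_function_divide:
  assumes "regular_function U f" "regular_function U g" "\<And>x. x \<in> U \<Longrightarrow> g x \<noteq> 0"
  shows "regular_function U (\<lambda>x. f x / g x)"
proof -
  obtain P Q where f: "real_polynomial_function P" "real_polynomial_function Q"
    "\<forall>x\<in>U. Q x \<noteq> 0 \<and> f x = P x / Q x"
    using assms unfolding regular_function_def by blast
  obtain P' Q' where g: "real_polynomial_function P'" "real_polynomial_function Q'"
    "\<forall>x\<in>U. Q' x \<noteq> 0 \<and> g x = P' x / Q' x"
    using assms unfolding regular_function_def by blast
  show ?thesis
    unfolding regular_function_def
    by (rule exI[of _ "\<lambda>x. P x * Q' x"], rule exI[of _ "\<lambda>x. Q x * P' x"])
      (use f g assms(3) in force)
qed

lemma regular_function_sum: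
  assumes "\<And>i. i \<in> I \<Longrightarrow> regular_function U (f i)"
  shows "regular_function U (\<lambda>x. \<Sum>i\<in>I. f i x)"
  using assms
  by (induction I rule: infinite_finite_induct)
    (auto intro: regular_function_add regular_function_polynomial[OF real_polynomial_function.intros(2)])

text \<open>
The target \<open>UNIV\<close> expresses that the coordinates are regular and puts no condition on
  the values, which is the form in which maps can be added, scaled and differentiated.
\<close>

lemma regular_map_UNIV:
  "regular_map U W f \<longleftrightarrow> regular_map U UNIV f \<and> f \<in> U \<rightarrow> W"
  unfolding regular_map_def by auto

lemma regular_map_polynomial:
  assumes "polynomial_function p" "p \<in> U \<rightarrow> W"
  shows "regular_map U W p"
  using assms unfolding regular_map_def polynomial_function_iff_Basis_inner
  by (auto intro: regular_function_polynomial)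

lemma regular_function_inner:
  assumes "regular_map U UNIV f" "regular_map U UNIV g"
  shows "regular_function U (\<lambda>x. f x \<bullet> g x)"
  using assms unfolding regular_map_def
  by (subst euclidean_inner) (auto intro!: regular_function_sum regular_function_mult)

lemma regular_map_add:
  assumes "regular_map U UNIV f" "regular_map U UNIV g"
  shows "regular_map U UNIV (\<lambda>x. f x + g x)"
  using assms unfolding regular_map_def by (auto simp: inner_simps intro: regular_function_add)

lemma regular_map_scaleR:
  assumes "regular_function U r" "regular_map U UNIV f"
  shows "regular_map U UNIV (\<lambda>x. r x *\<^sub>R f x)"
  using assms unfolding regular_map_def by (auto intro: regular_function_mult)

lemma regular_map_sum:
  assumes "\<And>i. i \<in> I \<Longrightarrow> regular_map U UNIV (f i)"
  shows "regular_map U UNIV (\<lambda>x. \<Sum>i\<in>I. f i x)"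
  using assms unfolding regular_map_def by (auto simp: inner_sum_left intro!: regular_function_sum)

lemma regular_map_Pair:
  assumes "regular_map U A f" "regular_map U B g"
  shows "regular_map U (A \<times> B) (\<lambda>x. (f x, g x))"
  using assms unfolding regular_map_def by (auto simp: Basis_prod_def Pi_iff)

lemma regular_function_compose_polynomial:
  assumes "real_polynomial_function p" "regular_map U UNIV f"
  shows "regular_function U (\<lambda>x. p (f x))"
  using assms(1)
proof (induction p rule: real_polynomial_function.induct)
  case (linear p)
  have "p (f x) = (\<Sum>b\<in>Basis. (f x \<bullet> b) * p b)" for x
  proof -
    have "p (f x) = p (\<Sum>b\<in>Basis. (f x \<bullet> b) *\<^sub>R b)"
      by (simp add: euclidean_representation)
    then show ?thesis
      using linear by (simp add: linear_sum bounded_linear.linear linear_scale)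
  qed
  then show ?case
    using assms(2)
    by (auto simp: regular_map_def intro!: regular_function_sum regular_function_mult
        regular_function_polynomial[OF real_polynomial_function.intros(2)])
qed (auto intro: regular_function_add regular_function_mult
      regular_function_polynomial[OF real_polynomial_function.intros(2)])

lemma regular_function_compose:
  assumes r: "regular_function W r" and f: "regular_map U W f"
  shows "regular_function U (\<lambda>x. r (f x))"
proof -
  obtain P Q where PQ: "real_polynomial_function P" "real_polynomial_function Q"
    "\<forall>x\<in>W. Q x \<noteq> 0 \<and> r x = P x / Q x"
    using r unfolding regular_function_def by blast
  have f': "regular_map U UNIV f" "f \<in> U \<rightarrow> W"
    using f regular_map_UNIV by blast+
  have "regular_function U (\<lambda>x. P (f x) / Q (f x))"
    using PQ f' by (intro regular_function_divide regular_function_compose_polynomial) auto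
  then show ?thesis
    using PQ(3) f'(2) by (subst regular_function_cong[where g = "\<lambda>x. P (f x) / Q (f x)"]) auto
qed

lemma regular_map_compose:
  assumes "regular_map W T g" "regular_map U W f"
  shows "regular_map U T (\<lambda>x. g (f x))"
  using assms regular_function_compose[OF _ assms(2)] unfolding regular_map_def by (auto simp: Pi_iff)

lemma regular_map_subset:
  assumes "regular_map U W f" "V \<subseteq> U" "W \<subseteq> T"
  shows "regular_map V T f"
  using assms unfolding regular_map_def by (auto intro: regular_function_subset)

text \<open>
The product of the denominators of the coordinates serves for all of them. A single
  denominator makes it possible to turn a regular map into a polynomial one by a scalar
  factor, and to extend it beyond the set on which it is given.
\<close>

lemma regular_map_common_denominator:
  fixes f :: "'a::euclidean_space \<Rightarrow> 'b::euclidean_space"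
  assumes "regular_map U W f"
  obtains p q where "polynomial_function p" "real_polynomial_function q"
    "\<And>x. x \<in> U \<Longrightarrow> q x \<noteq> 0 \<and> f x = p x /\<^sub>R q x"
proof -
  have "\<forall>b\<in>Basis. \<exists>P Q. real_polynomial_function P \<and> real_polynomial_function Q \<and>
      (\<forall>x\<in>U. Q x \<noteq> 0 \<and> f x \<bullet> b = P x / Q x)"
    using assms unfolding regular_map_def regular_function_def by blast
  then obtain P Q where PQ: "\<And>b. b \<in> Basis \<Longrightarrow> real_polynomial_function (P b)"
      "\<And>b. b \<in> Basis \<Longrightarrow> real_polynomial_function (Q b)"
      "\<And>b x. b \<in> Basis \<Longrightarrow> x \<in> U \<Longrightarrow> Q b x \<noteq> 0 \<and> f x \<bullet> b = P b x / Q b x"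
    by metis
  define q where "q x = (\<Prod>b\<in>Basis. Q b x)" for x
  define p where "p x = (\<Sum>b\<in>Basis. (P b x * (\<Prod>c\<in>Basis - {b}. Q c x)) *\<^sub>R b)" for x
  have "polynomial_function p"
    unfolding polynomial_function_iff_Basis_inner
    using PQ by (auto simp: p_def inner_sum_left inner_Basis if_distrib cong: if_cong
        intro!: real_polynomial_function.intros(4) real_polynomial_function_prod)
  moreover have "real_polynomial_function q"
    unfolding q_def using PQ by (intro real_polynomial_function_prod) auto
  moreover have "q x \<noteq> 0 \<and> f x = p x /\<^sub>R q x" if "x \<in> U" for x
  proof
    show q: "q x \<noteq> 0"
      unfolding q_def using PQ(3) that by auto
    show "f x = p x /\<^sub>R q x"
    proof (rule euclidean_eqI)
      fix b :: 'b assume b: "b \<in> Basis"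
      have "q x = Q b x * (\<Prod>c\<in>Basis - {b}. Q c x)"
        unfolding q_def using b by (simp add: prod.remove)
      moreover have "p x \<bullet> b = P b x * (\<Prod>c\<in>Basis - {b}. Q c x)"
        unfolding p_def using b
        by (simp add: inner_sum_left inner_Basis if_distrib cong: if_cong)
      ultimately show "f x \<bullet> b = (p x /\<^sub>R q x) \<bullet> b"
        using PQ(3)[OF b that] q by (simp add: field_simps)
    qed
  qed
  ultimately show ?thesis using that by blast
qed

text \<open>
A regular map on an algebraic set says nothing about nearby points of the ambient space, so
  it has no derivative there. Its quotient representation is meaningful wherever the
  denominator does not vanish, and that set is open.
\<close>

lemma regular_map_open_extension:
  assumes "regular_map U W f"
  obtains \<Omega> f' where "open \<Omega>" "U \<subseteq> \<Omega>" "regular_map \<Omega> UNIV f'" "\<And>x. x \<in> U \<Longrightarrow> f' x = f x"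
proof -
  obtain p q where pq: "polynomial_function p" "real_polynomial_function q"
    "\<And>x. x \<in> U \<Longrightarrow> q x \<noteq> 0 \<and> f x = p x /\<^sub>R q x"
    using regular_map_common_denominator[OF assms] by metis
  let ?\<Omega> = "{x. q x \<noteq> 0}"
  have "open ?\<Omega>"
    by (intro open_Collect_neq continuous_on_const continuous_on_polymonial_function)
      (use pq(2) real_polynomial_function_eq in blast)
  moreover have "regular_map ?\<Omega> UNIV (\<lambda>x. p x /\<^sub>R q x)"
  proof (rule regular_map_scaleR)
    have "regular_function ?\<Omega> (\<lambda>x. 1 / q x)"
      using pq(2) by (intro regular_function_divide regular_function_polynomial) auto
    then show "regular_function ?\<Omega> (\<lambda>x. inverse (q x))"
      by (simp add: divide_inverse)
    show "regular_map ?\<Omega> UNIV p"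
      using pq(1) by (rule regular_map_polynomial) simp
  qed
  ultimately show ?thesis
    using pq(3) that[of ?\<Omega> "\<lambda>x. p x /\<^sub>R q x"] by auto
qed


section \<open>Derivatives of regular maps and the Zariski tangent space\<close>

lemma real_polynomial_function_C1:
  assumes "real_polynomial_function P"
  obtains D where "\<And>x. (P has_derivative D x) (at x)" "\<And>v. continuous_on UNIV (\<lambda>x. D x v)"
proof -
  have "\<exists>D. (\<forall>x. (P has_derivative D x) (at x)) \<and> (\<forall>v. continuous_on UNIV (\<lambda>x. D x v))"
    using assms
  proof (induction P rule: real_polynomial_function.induct)
    case (linear f)
    then show ?case
      by (intro exI[of _ "\<lambda>_. f"]) (auto intro: bounded_linear_imp_has_derivative)
  next
    case (const c)
    then show ?case
      by (intro exI[of _ "\<lambda>_ _. 0"]) auto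
  next
    case (add f g)
    then obtain D E where D: "\<And>x. (f has_derivative D x) (at x)" "\<And>v. continuous_on UNIV (\<lambda>x. D x v)"
      and E: "\<And>x. (g has_derivative E x) (at x)" "\<And>v. continuous_on UNIV (\<lambda>x. E x v)"
      by blast
    show ?case
      by (rule exI[of _ "\<lambda>x v. D x v + E x v"])
        (auto intro!: has_derivative_add continuous_on_add D E)
  next
    case (mult f g)
    then obtain D E where D: "\<And>x. (f has_derivative D x) (at x)" "\<And>v. continuous_on UNIV (\<lambda>x. D x v)"
      and E: "\<And>x. (g has_derivative E x) (at x)" "\<And>v. continuous_on UNIV (\<lambda>x. E x v)"
      by blast
    have "continuous_on UNIV f" "continuous_on UNIV g"
      by (auto intro!: has_derivative_continuous_on D(1) E(1))
    then show ?case
      by (intro exI[of _ "\<lambda>x v. f x * E x v + D x v * g x"])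
        (auto intro!: has_derivative_mult continuous_on_add continuous_on_mult D E)
  qed
  then show ?thesis using that by blast
qed

lemma polynomial_function_C1:
  fixes p :: "'a::euclidean_space \<Rightarrow> 'b::euclidean_space"
  assumes "polynomial_function p"
  obtains D where "\<And>x. (p has_derivative D x) (at x)" "\<And>v. continuous_on UNIV (\<lambda>x. D x v)"
proof -
  have "\<forall>b\<in>Basis. \<exists>D. (\<forall>x. ((\<lambda>x. p x \<bullet> b) has_derivative D x) (at x)) \<and>
      (\<forall>v. continuous_on UNIV (\<lambda>x. D x v))"
    using assms real_polynomial_function_C1 unfolding polynomial_function_iff_Basis_inner by metis
  then obtain D where D: "\<And>b x. b \<in> Basis \<Longrightarrow> ((\<lambda>x. p x \<bullet> b) has_derivative D b x) (at x)"
      "\<And>b v. b \<in> Basis \<Longrightarrow> continuous_on UNIV (\<lambda>x. D b x v)"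
    by metis
  define E where "E x v = (\<Sum>b\<in>Basis. D b x v *\<^sub>R b)" for x v
  have "(p has_derivative E x) (at x)" for x
    unfolding has_derivative_componentwise_within[of p]
    using D(1) by (auto simp: E_def)
  moreover have "continuous_on UNIV (\<lambda>x. E x v)" for v
    unfolding E_def by (auto intro!: continuous_intros D(2))
  ultimately show ?thesis using that by blast
qed

text \<open>
Continuity of the derivative is expressed direction by direction. In finite dimension this
  amounts to continuity in the operator norm.
\<close>

lemma regular_map_C1:
  fixes f :: "'a::euclidean_space \<Rightarrow> 'b::euclidean_space"
  assumes "regular_map \<Omega> W f" "open \<Omega>"
  obtains D where "\<And>x. x \<in> \<Omega> \<Longrightarrow> (f has_derivative D x) (at x)"
    "\<And>v. continuous_on \<Omega> (\<lambda>x. D x v)"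
proof -
  obtain p q where pq: "polynomial_function p" "real_polynomial_function q"
    "\<And>x. x \<in> \<Omega> \<Longrightarrow> q x \<noteq> 0 \<and> f x = p x /\<^sub>R q x"
    using regular_map_common_denominator[OF assms(1)] by metis
  obtain D where D: "\<And>x. (p has_derivative D x) (at x)" "\<And>v. continuous_on UNIV (\<lambda>x. D x v)"
    using polynomial_function_C1[OF pq(1)] by metis
  obtain E where E: "\<And>x. (q has_derivative E x) (at x)" "\<And>v. continuous_on UNIV (\<lambda>x. E x v)"
    using real_polynomial_function_C1[OF pq(2)] by metis
  have cont: "continuous_on A p" "continuous_on A q" for A
    using has_derivative_continuous_on[of UNIV] D(1) E(1) continuous_on_subset by blast+
  define G where "G x v = inverse (q x) *\<^sub>R D x v + (- (inverse (q x) * E x v * inverse (q x))) *\<^sub>R p x"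
    for x v
  have "(f has_derivative G x) (at x)" if "x \<in> \<Omega>" for x
  proof (rule has_derivative_transform_within_open[OF _ assms(2) that])
    show "((\<lambda>x. inverse (q x) *\<^sub>R p x) has_derivative G x) (at x)"
      unfolding G_def using pq(3)[OF that]
      by (intro has_derivative_scaleR Deriv.has_derivative_inverse D E) auto
  qed (use pq(3) in auto)
  moreover have "continuous_on \<Omega> (\<lambda>x. G x v)" for v
    unfolding G_def using pq(3)
    by (intro continuous_intros cont continuous_on_subset[OF D(2)] continuous_on_subset[OF E(2)]) auto
  ultimately show ?thesis using that by blast
qed

lemma regular_map_continuous_on:
  assumes "regular_map U W f"
  shows "continuous_on U f"
proof -
  obtain \<Omega> f' where *: "open \<Omega>" "U \<subseteq> \<Omega>" "regular_map \<Omega> UNIV f'" "\<And>x. x \<in> U \<Longrightarrow> f' x = f x"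
    using regular_map_open_extension[OF assms] by metis
  obtain D where "\<And>x. x \<in> \<Omega> \<Longrightarrow> (f' has_derivative D x) (at x)"
    using regular_map_C1[OF *(3,1)] by metis
  then have "continuous_on \<Omega> f'"
    by (blast intro: has_derivative_continuous_on has_derivative_at_withinI)
  then have "continuous_on U f'"
    using *(2) by (rule continuous_on_subset)
  then show ?thesis
    using *(4) by (simp cong: continuous_on_cong)
qed

text \<open>
The mean value inequality applied to \<open>f\<close> minus its linearisation at \<open>a\<close>. Both points
  move while the derivative is frozen at \<open>a\<close>: this uniformity is needed for limits of secants
  and for difference quotients whose base point varies in a compact set.
\<close>

lemma C1_strictly_differentiable:
  fixes f :: "'a::euclidean_space \<Rightarrow> 'b::real_normed_vector"
  assumes "open \<Omega>" "a \<in> \<Omega>" and D: "\<And>x. x \<in> \<Omega> \<Longrightarrow> (f has_derivative D x) (at x)"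
    and cont: "\<And>v. continuous_on \<Omega> (\<lambda>x. D x v)" and "0 < \<eta>"
  obtains r where "0 < r"
    "\<And>x y. x \<in> ball a r \<Longrightarrow> y \<in> ball a r \<Longrightarrow> norm (f y - f x - D a (y - x)) \<le> \<eta> * norm (y - x)"
proof -
  let ?n = "real DIM('a)"
  have "eventually (\<lambda>x. \<forall>b\<in>Basis. norm (D x b - D a b) < \<eta> / ?n) (at a)"
  proof (rule eventually_ball_finite, simp, rule)
    fix b :: 'a
    have "((\<lambda>x. D x b) \<longlongrightarrow> D a b) (at a)"
      using cont assms(1,2) by (metis continuous_on_eq_continuous_at isCont_def)
    then show "\<forall>\<^sub>F x in at a. norm (D x b - D a b) < \<eta> / ?n"
      using \<open>0 < \<eta>\<close> by (auto simp: tendsto_iff dist_norm)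
  qed
  moreover have "eventually (\<lambda>x. x \<in> \<Omega>) (at a)"
    using assms(1,2) by (simp add: eventually_at_topological) blast
  ultimately have "eventually (\<lambda>x. x \<in> \<Omega> \<and> (\<forall>b\<in>Basis. norm (D x b - D a b) < \<eta> / ?n)) (at a)"
    by eventually_elim auto
  then obtain r where "r > 0"
    and "\<And>x. x \<noteq> a \<Longrightarrow> dist x a < r \<Longrightarrow> x \<in> \<Omega> \<and> (\<forall>b\<in>Basis. norm (D x b - D a b) < \<eta> / ?n)"
    by (auto simp: eventually_at)
  then have r': "x \<in> \<Omega> \<and> (\<forall>b\<in>Basis. norm (D x b - D a b) \<le> \<eta> / ?n)" if "x \<in> ball a r" for x
    using that assms(2,5) by (cases "x = a") (simp_all add: dist_commute less_imp_le)
  then have r: "x \<in> \<Omega>" "\<And>b. b \<in> Basis \<Longrightarrow> norm (D x b - D a b) \<le> \<eta> / ?n" if "x \<in> ball a r" for x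
    using that by blast+
  have lin: "linear (D x)" if "x \<in> \<Omega>" for x
    using D[OF that] has_derivative_linear by blast
  have bound: "onorm (\<lambda>v. D x v - D a v) \<le> \<eta>" if x: "x \<in> ball a r" for x
  proof (rule onorm_le)
    fix v
    have l: "linear (\<lambda>v. D x v - D a v)"
      using lin r(1)[OF x] assms(2) by (intro linear_compose_sub) auto
    have "D x v - D a v = (\<lambda>v. D x v - D a v) (\<Sum>b\<in>Basis. (v \<bullet> b) *\<^sub>R b)"
      by (simp add: euclidean_representation)
    also have "\<dots> = (\<Sum>b\<in>Basis. (v \<bullet> b) *\<^sub>R (D x b - D a b))"
      by (simp only: linear_sum[OF l] linear_scale[OF l])
    also have "norm \<dots> \<le> (\<Sum>b\<in>(Basis::'a set). norm v * (\<eta> / ?n))"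
    proof (rule sum_norm_le)
      fix b :: 'a assume b: "b \<in> Basis"
      show "norm ((v \<bullet> b) *\<^sub>R (D x b - D a b)) \<le> norm v * (\<eta> / ?n)"
        unfolding norm_scaleR real_norm_def
        using Basis_le_norm[OF b] r(2)[OF x b] by (rule mult_mono) auto
    qed
    finally show "norm (D x v - D a v) \<le> \<eta> * norm v"
      by (simp add: mult.commute)
  qed
  have "norm (f y - f x - D a (y - x)) \<le> \<eta> * norm (y - x)" if "x \<in> ball a r" "y \<in> ball a r" for x y
  proof -
    have "norm ((f y - D a y) - (f x - D a x)) \<le> \<eta> * norm (y - x)"
    proof (rule differentiable_bound[OF convex_ball])
      fix z assume z: "z \<in> ball a r"
      show "((\<lambda>z. f z - D a z) has_derivative (\<lambda>v. D z v - D a v)) (at z within ball a r)"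
        by (intro has_derivative_diff has_derivative_at_withinI[OF D[OF r(1)[OF z]]]
            bounded_linear_imp_has_derivative has_derivative_bounded_linear[OF D[OF assms(2)]])
      show "onorm (\<lambda>v. D z v - D a v) \<le> \<eta>"
        by (rule bound[OF z])
    qed (use that in auto)
    moreover have "D a (y - x) = D a y - D a x"
      using lin[OF assms(2)] by (simp add: linear_diff)
    moreover have "f y - f x - (D a y - D a x) = (f y - D a y) - (f x - D a x)"
      by simp
    ultimately show ?thesis by metis
  qed
  then show ?thesis using that \<open>r > 0\<close> by blast
qed

lemma gradient_inner:
  assumes "(P has_derivative P') (at x)"
  shows "gradient P x \<bullet> v = P' v"
proof -
  have "frechet_derivative P (at x) = P'"
    using assms frechet_derivative_at by metis
  moreover have "P' v = (\<Sum>b\<in>Basis. (v \<bullet> b) * P' b)"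
  proof -
    have l: "linear P'" using assms has_derivative_linear by blast
    have "P' v = P' (\<Sum>b\<in>Basis. (v \<bullet> b) *\<^sub>R b)" by (simp add: euclidean_representation)
    then show ?thesis by (simp only: linear_sum[OF l] linear_scale[OF l] real_scaleR_def)
  qed
  moreover have "gradient P x \<bullet> v = (\<Sum>b\<in>Basis. frechet_derivative P (at x) b * (v \<bullet> b))"
    unfolding gradient_def inner_sum_left inner_scaleR_left by (simp only: inner_commute)
  ultimately show ?thesis by (simp add: mult.commute)
qed

text \<open>
The Zariski tangent space is defined by polynomials that vanish on \<open>A\<close>. Clearing the
  denominator turns each coordinate of \<open>R\<close> into such a polynomial, and the factor does not
  affect the vanishing of the derivative because \<open>R\<close> vanishes at \<open>a\<close>. Consequently regular
  maps that agree on \<open>A\<close> have the same differential on the tangent space, whatever their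
  extensions are.
\<close>

lemma derivative_zero_on_tangent_space:
  fixes R :: "'a::euclidean_space \<Rightarrow> 'b::euclidean_space"
  assumes R: "regular_map \<Omega> UNIV R" and "open \<Omega>" "A \<subseteq> \<Omega>" "a \<in> A"
    and zero: "\<And>x. x \<in> A \<Longrightarrow> R x = 0"
    and R': "(R has_derivative R') (at a)" and u: "u \<in> tangent_space A a"
  shows "R' u = 0"
proof (rule euclidean_eqI)
  fix b :: 'b assume b: "b \<in> Basis"
  obtain P Q where PQ: "real_polynomial_function P" "real_polynomial_function Q"
    "\<forall>x\<in>\<Omega>. Q x \<noteq> 0 \<and> R x \<bullet> b = P x / Q x"
    using R b unfolding regular_map_def regular_function_def by blast
  have P0: "P x = 0" if "x \<in> A" for x
  proof -
    have "Q x \<noteq> 0 \<and> R x \<bullet> b = P x / Q x"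
      using PQ(3) assms(3) that by blast
    then show ?thesis using zero[OF that] by auto
  qed
  obtain P' where P': "(P has_derivative P') (at a)"
    using real_polynomial_function_C1[OF PQ(1)] by metis
  obtain Q' where Q': "(Q has_derivative Q') (at a)"
    using real_polynomial_function_C1[OF PQ(2)] by metis
  have "P' u = 0"
    using u P0 PQ(1) gradient_inner[OF P', of u] unfolding tangent_space_def by auto
  have "a \<in> \<Omega>" using assms by blast
  \<comment> \<open>Differentiate \<open>Q \<cdot> (R \<bullet> b) = P\<close> at \<open>a\<close>, where both \<open>R\<close> and \<open>P\<close> vanish.\<close>
  have "((\<lambda>x. Q x * (R x \<bullet> b)) has_derivative (\<lambda>v. Q a * (R' v \<bullet> b) + Q' v * (R a \<bullet> b))) (at a)"
    by (intro has_derivative_mult Q' has_derivative_inner_left R')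
  then have "(P has_derivative (\<lambda>v. Q a * (R' v \<bullet> b) + Q' v * (R a \<bullet> b))) (at a)"
    by (rule has_derivative_transform_within_open[OF _ \<open>open \<Omega>\<close> \<open>a \<in> \<Omega>\<close>]) (use PQ(3) in auto)
  then have "P' u = Q a * (R' u \<bullet> b) + Q' u * (R a \<bullet> b)"
    using has_derivative_unique[OF P'] by metis
  then show "R' u \<bullet> b = 0 \<bullet> b"
    using \<open>P' u = 0\<close> zero[OF \<open>a \<in> A\<close>] PQ(3) \<open>a \<in> \<Omega>\<close> by auto
qed


section \<open>Polynomial sections of algebraic subbundles\<close>

lemma regular_map_pair_left:
  fixes k :: "'b::euclidean_space \<times> 'f::euclidean_space \<Rightarrow> 'c::euclidean_space"
  assumes "regular_map (U \<times> K) W k" "e \<in> K"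
  shows "regular_map U W (\<lambda>y. k (y, e))"
proof -
  have "polynomial_function (\<lambda>y::'b. (y, e))"
    unfolding polynomial_function_iff_Basis_inner
    by (auto simp: Basis_prod_def 
        intro: real_polynomial_function.intros(1)[OF bounded_linear_inner_left] real_polynomial_function.intros(2))
  then have "regular_map U (U \<times> K) (\<lambda>y. (y, e))"
    using assms(2) by (intro regular_map_polynomial) auto
  from regular_map_compose[OF assms(1) this] show ?thesis .
qed

lemma regular_map_snd:
  fixes f :: "'a::euclidean_space \<Rightarrow> 'b::euclidean_space \<times> 'f::euclidean_space"
  assumes "regular_map U W f"
  shows "regular_map U UNIV (\<lambda>x. snd (f x))"
proof -
  have "regular_function U (\<lambda>x. snd (f x) \<bullet> b)" if "b \<in> Basis" for b
  proof -
    have "(0, b) \<in> Basis" using that by (auto simp: Basis_prod_def)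
    then have "regular_function U (\<lambda>x. f x \<bullet> (0, b))"
      using assms unfolding regular_map_def by blast
    then show ?thesis by (simp add: inner_prod_def)
  qed
  then show ?thesis by (auto simp: regular_map_def)
qed

text \<open>
A trivialisation over the Zariski open set \<open>U\<close> transports a basis of the model fibre to
  regular sections over \<open>U\<close>, and the coordinates of the trivialisation express any vector of
  \<open>F\<close> in terms of them. These sections become polynomial, and extend to all of \<open>Y\<close>, after
  multiplication by their denominator and by a polynomial \<open>R\<close> that vanishes on \<open>Y - U\<close>: where
  \<open>R\<close> vanishes, the section is zero and so lies in the fibre. They still span the fibres
  where \<open>R\<close> is nonzero, in particular near \<open>y0\<close>.
\<close>

lemma algebraic_subbundle_local_sections:
  fixes F :: "('b::euclidean_space \<times> 'f::euclidean_space) set"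
  assumes F: "algebraic_subbundle Y F" and y0: "y0 \<in> Y"
  obtains I :: "'f set" and \<sigma> :: "'f \<Rightarrow> 'b \<Rightarrow> 'f" and \<gamma> :: "'f \<Rightarrow> 'b \<times> 'f \<Rightarrow> real" and \<Omega>
  where "finite I" "open \<Omega>" "y0 \<in> \<Omega>"
    "\<And>i. i \<in> I \<Longrightarrow> polynomial_function (\<sigma> i)"
    "\<And>i y. i \<in> I \<Longrightarrow> y \<in> Y \<Longrightarrow> (y, \<sigma> i y) \<in> F"
    "\<And>i. i \<in> I \<Longrightarrow> continuous_on (F \<inter> (\<Omega> \<times> UNIV)) (\<gamma> i)"
    "\<And>y v. (y, v) \<in> F \<Longrightarrow> y \<in> \<Omega> \<Longrightarrow> v = (\<Sum>i\<in>I. \<gamma> i (y, v) *\<^sub>R \<sigma> i y)"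
proof -
  have FY: "fst ` F \<subseteq> Y" and sub: "\<And>y. y \<in> Y \<Longrightarrow> subspace {v. (y, v) \<in> F}"
    using F unfolding algebraic_subbundle_def by auto
  obtain U K h where "zariski_open_in Y U" and y0U: "y0 \<in> U" and K: "subspace (K :: 'f set)" and
    bi: "biregular_map (F \<inter> (U \<times> UNIV)) (U \<times> K) h" and
    fst_h: "\<And>w. w \<in> F \<inter> (U \<times> UNIV) \<Longrightarrow> fst (h w) = fst w" and
    h_add: "\<And>z u v. z \<in> U \<Longrightarrow> (z, u) \<in> F \<Longrightarrow> (z, v) \<in> F \<Longrightarrow>
           snd (h (z, u + v)) = snd (h (z, u)) + snd (h (z, v))" and
    h_scale: "\<And>z c u. z \<in> U \<Longrightarrow> (z, u) \<in> F \<Longrightarrow> snd (h (z, c *\<^sub>R u)) = c *\<^sub>R snd (h (z, u))"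
    using F y0 unfolding algebraic_subbundle_def by metis
  then obtain Z where "algebraic_set Z" and U: "U = Y - Z" unfolding zariski_open_in_def by blast
  then obtain R where R: "real_polynomial_function R" "R y0 \<noteq> 0" "\<And>z. z \<in> Z \<Longrightarrow> R z = 0"
    using y0U unfolding algebraic_set_def by blast
  obtain k where k: "regular_map (U \<times> K) (F \<inter> (U \<times> UNIV)) k"
    and kh: "\<And>w. w \<in> F \<inter> (U \<times> UNIV) \<Longrightarrow> k (h w) = w"
    and hk: "\<And>w. w \<in> U \<times> K \<Longrightarrow> h (k w) = w"
    and h: "regular_map (F \<inter> (U \<times> UNIV)) (U \<times> K) h"
    using bi unfolding biregular_map_def by blast
  have kF: "k (y, e) \<in> F" "fst (k (y, e)) = y" if "y \<in> U" "e \<in> K" for y e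
  proof -
    have *: "k (y, e) \<in> F \<inter> (U \<times> UNIV)" using k that unfolding regular_map_def by auto
    then show "k (y, e) \<in> F" by blast
    show "fst (k (y, e)) = y" using fst_h[OF *] hk[of "(y, e)"] that by auto
  qed
  then have kF': "(y, snd (k (y, e))) \<in> F" "k (y, e) = (y, snd (k (y, e)))" if "y \<in> U" "e \<in> K" for y e
    using that by (metis prod.collapse)+
  obtain B where B: "B \<subseteq> K" "pairwise orthogonal B" "\<And>x. x \<in> B \<Longrightarrow> norm x = 1"
      "independent B" "card B = dim K" "span B = K"
    using orthonormal_basis_subspace[OF K] by metis
  have finB: "finite B" using B(4) independent_imp_finite by blast
  have "\<forall>e\<in>B. \<exists>p q. polynomial_function p \<and> real_polynomial_function q \<and>
      (\<forall>y\<in>U. q y \<noteq> 0 \<and> snd (k (y, e)) = p y /\<^sub>R q y)"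
  proof
    fix e assume "e \<in> B"
    then have "regular_map U UNIV (\<lambda>y. snd (k (y, e)))"
      using B(1) by (intro regular_map_snd[OF regular_map_pair_left[OF k]]) auto
    from regular_map_common_denominator[OF this]
    show "\<exists>p q. polynomial_function p \<and> real_polynomial_function q \<and>
      (\<forall>y\<in>U. q y \<noteq> 0 \<and> snd (k (y, e)) = p y /\<^sub>R q y)" by metis
  qed
  then obtain p q where pq: "\<And>e. e \<in> B \<Longrightarrow> polynomial_function (p e)"
      "\<And>e. e \<in> B \<Longrightarrow> real_polynomial_function (q e)"
      "\<And>e y. e \<in> B \<Longrightarrow> y \<in> U \<Longrightarrow> q e y \<noteq> 0 \<and> snd (k (y, e)) = p e y /\<^sub>R q e y"
    by metis
  define \<sigma> where "\<sigma> e y = R y *\<^sub>R p e y" for e y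
  define \<gamma> where "\<gamma> e w = (snd (h w) \<bullet> e) / (R (fst w) * q e (fst w))" for e w
  define \<Omega> where "\<Omega> = {y. R y \<noteq> 0}"
  have \<Omega>U: "y \<in> U" "R y \<noteq> 0" if "y \<in> Y" "y \<in> \<Omega>" for y
    using that R(3) U unfolding \<Omega>_def by auto
  show ?thesis
  proof (rule that)
    show "finite B" by fact
    show "open \<Omega>" unfolding \<Omega>_def
      by (intro open_Collect_neq continuous_on_const continuous_on_polymonial_function)
        (use R(1) real_polynomial_function_eq in blast)
    show "y0 \<in> \<Omega>" using R(2) \<Omega>_def by simp
    show "polynomial_function (\<sigma> e)" if "e \<in> B" for e
      unfolding \<sigma>_def using R(1) pq(1)[OF that] real_polynomial_function_eq by blast
    have \<sigma>_U: "\<sigma> e y = (R y * q e y) *\<^sub>R snd (k (y, e))" if "e \<in> B" "y \<in> U" for e y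
      unfolding \<sigma>_def using pq(3)[OF that] by simp
    show "(y, \<sigma> e y) \<in> F" if "e \<in> B" "y \<in> Y" for e y
    proof (cases "y \<in> U")
      case True
      then have "(y, snd (k (y, e))) \<in> F" using kF' B(1) that(1) by blast
      then show ?thesis
        using \<sigma>_U[OF that(1) True] subspace_mul[OF sub[OF that(2)]] by simp
    next
      case False
      then have "R y = 0" using R(3) U that(2) by blast
      then show ?thesis using subspace_0[OF sub[OF that(2)]] by (simp add: \<sigma>_def)
    qed
    show "continuous_on (F \<inter> (\<Omega> \<times> UNIV)) (\<gamma> e)" if "e \<in> B" for e
    proof -
      have sub: "F \<inter> (\<Omega> \<times> UNIV) \<subseteq> F \<inter> (U \<times> UNIV)" using \<Omega>U FY by force
      have "continuous_on (F \<inter> (\<Omega> \<times> UNIV)) h"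
        using regular_map_continuous_on[OF h] sub continuous_on_subset by blast
      moreover have "continuous_on A (\<lambda>w. R (fst w))" "continuous_on A (\<lambda>w. q e (fst w))"
        for A :: "('b \<times> 'f) set"
        by (rule continuous_on_compose2[OF continuous_on_polymonial_function[where S=UNIV]];
            use R(1) pq(2)[OF that] real_polynomial_function_eq in
              \<open>auto intro: continuous_on_fst continuous_on_id\<close>)+
      moreover have "R (fst w) * q e (fst w) \<noteq> 0" if w: "w \<in> F \<inter> (\<Omega> \<times> UNIV)" for w
        using \<Omega>U[of "fst w"] FY w pq(3)[OF \<open>e \<in> B\<close>, of "fst w"] by auto
      ultimately show ?thesis
        unfolding \<gamma>_def by (intro continuous_intros) auto
    qed
    show "v = (\<Sum>e\<in>B. \<gamma> e (y, v) *\<^sub>R \<sigma> e y)" if yv: "(y, v) \<in> F" and y: "y \<in> \<Omega>" for y v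
    proof -
      have yY: "y \<in> Y" using yv FY by force
      note yU = \<Omega>U[OF yY y]
      have terms: "\<gamma> e (y, v) *\<^sub>R \<sigma> e y = (snd (h (y, v)) \<bullet> e) *\<^sub>R snd (k (y, e))" if "e \<in> B" for e
        using \<sigma>_U[OF that yU(1)] pq(3)[OF that yU(1)] yU(2) by (simp add: \<gamma>_def divide_inverse)
      \<comment> \<open>\<open>h\<close> is linear on the fibre, so it maps a combination of the sections to the same
        combination of the basis vectors.\<close>
      have comb: "(y, \<Sum>e\<in>A. c e *\<^sub>R snd (k (y, e))) \<in> F \<and>
          snd (h (y, \<Sum>e\<in>A. c e *\<^sub>R snd (k (y, e)))) = (\<Sum>e\<in>A. c e *\<^sub>R e)" if "finite A" "A \<subseteq> B" for A c
        using that
      proof (induction A)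
        case empty
        have "snd (h (y, 0)) = 0" using h_scale[OF yU(1) yv, of 0] by simp
        then show ?case using subspace_0[OF sub[OF yY]] by simp
      next
        case (insert e A)
        have eF: "(y, snd (k (y, e))) \<in> F" "h (y, snd (k (y, e))) = (y, e)"
          using kF'[OF yU(1), of e] hk[of "(y, e)"] insert.prems B(1) yU(1) by auto
        then have "(y, c e *\<^sub>R snd (k (y, e))) \<in> F" using subspace_mul[OF sub[OF yY]] by simp
        then show ?case
          using insert eF h_add[OF yU(1), of "c e *\<^sub>R snd (k (y, e))" "\<Sum>e\<in>A. c e *\<^sub>R snd (k (y, e))"]
            h_scale[OF yU(1) eF(1), of "c e"] subspace_add[OF sub[OF yY]] by simp
      qed
      let ?w = "\<Sum>e\<in>B. (snd (h (y, v)) \<bullet> e) *\<^sub>R snd (k (y, e))"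
      have vU: "(y, v) \<in> F \<inter> (U \<times> UNIV)" using yv yU by simp
      have "h (y, v) \<in> U \<times> K" using h vU unfolding regular_map_def by blast
      then have "snd (h (y, v)) \<in> span B" using B(6) by auto
      then have "snd (h (y, ?w)) = snd (h (y, v))"
        using comb[OF finB subset_refl] orthonormal_basis_expand[OF B(2,3) _ finB] by simp
      moreover have wU: "(y, ?w) \<in> F \<inter> (U \<times> UNIV)" using comb[OF finB subset_refl] yU by simp
      ultimately have "h (y, ?w) = h (y, v)"
        using fst_h[OF vU] fst_h[OF wU] by (simp add: prod_eq_iff)
      then have "?w = v" using kh[OF vU] kh[OF wU] by auto
      then show ?thesis using terms by simp
    qed
  qed
qed

text \<open>
The local sections over a finite cover of \<open>C\<close> are already defined on all of \<open>Y\<close>; only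
  their coefficients \<open>\<gamma>\<close> have to be patched, and these need only be continuous, so a partition
  of unity does it. The index of a section consists of the centre of its ball and its index
  there.
\<close>

lemma algebraic_subbundle_compact_sections:
  fixes F :: "('b::euclidean_space \<times> 'f::euclidean_space) set"
  assumes F: "algebraic_subbundle Y F" and C: "compact C" "C \<subseteq> Y"
  obtains I :: "('b \<times> 'f) set" and \<sigma> :: "'b \<times> 'f \<Rightarrow> 'b \<Rightarrow> 'f" and \<gamma> :: "'b \<times> 'f \<Rightarrow> 'b \<times> 'f \<Rightarrow> real"
  where "finite I"
    "\<And>i. i \<in> I \<Longrightarrow> polynomial_function (\<sigma> i)"
    "\<And>i y. i \<in> I \<Longrightarrow> y \<in> Y \<Longrightarrow> (y, \<sigma> i y) \<in> F"
    "\<And>i. i \<in> I \<Longrightarrow> continuous_on (F \<inter> (C \<times> UNIV)) (\<gamma> i)"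
    "\<And>y v. (y, v) \<in> F \<Longrightarrow> y \<in> C \<Longrightarrow> v = (\<Sum>i\<in>I. \<gamma> i (y, v) *\<^sub>R \<sigma> i y)"
proof -
  define good where "good y0 J s g r \<longleftrightarrow> finite J \<and> 0 < r \<and> (\<forall>i\<in>J. polynomial_function (s i)) \<and>
      (\<forall>i\<in>J. \<forall>y\<in>Y. (y, s i y) \<in> F) \<and>
      (\<forall>i\<in>J. continuous_on (F \<inter> (cball y0 r \<times> UNIV)) (g i)) \<and>
      (\<forall>y v. (y, v) \<in> F \<and> y \<in> cball y0 r \<longrightarrow> v = (\<Sum>i\<in>J. g i (y, v) *\<^sub>R s i y))"
    for y0 r and J :: "'f set" and s :: "'f \<Rightarrow> 'b \<Rightarrow> 'f" and g :: "'f \<Rightarrow> 'b \<times> 'f \<Rightarrow> real"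
  have "\<exists>J s g r. good y0 J s g r" if "y0 \<in> C" for y0
  proof -
    have "y0 \<in> Y" using that C by blast
    show ?thesis
    proof (rule algebraic_subbundle_local_sections[OF F \<open>y0 \<in> Y\<close>])
      fix J :: "'f set" and s :: "'f \<Rightarrow> 'b \<Rightarrow> 'f" and g :: "'f \<Rightarrow> 'b \<times> 'f \<Rightarrow> real" and \<Omega>
      assume J: "finite J" "open \<Omega>" "y0 \<in> \<Omega>" "\<And>i. i \<in> J \<Longrightarrow> polynomial_function (s i)"
        "\<And>i y. i \<in> J \<Longrightarrow> y \<in> Y \<Longrightarrow> (y, s i y) \<in> F"
        "\<And>i. i \<in> J \<Longrightarrow> continuous_on (F \<inter> (\<Omega> \<times> UNIV)) (g i)"
        "\<And>y v. (y, v) \<in> F \<Longrightarrow> y \<in> \<Omega> \<Longrightarrow> v = (\<Sum>i\<in>J. g i (y, v) *\<^sub>R s i y)"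
      obtain r where r: "0 < r" "cball y0 r \<subseteq> \<Omega>"
        using J(2,3) open_contains_cball by metis
      then have "F \<inter> (cball y0 r \<times> UNIV) \<subseteq> F \<inter> (\<Omega> \<times> UNIV)" by blast
      then have "\<forall>i\<in>J. continuous_on (F \<inter> (cball y0 r \<times> UNIV)) (g i)"
        using J(6) continuous_on_subset by blast
      then have "good y0 J s g r"
        unfolding good_def using J(1,4,5) r J(7) by blast
      then show ?thesis by blast
    qed
  qed
  then obtain J s g r where good: "\<And>y0. y0 \<in> C \<Longrightarrow> good y0 (J y0) (s y0) (g y0) (r y0)"
    by metis
  then have J: "\<And>y0. y0 \<in> C \<Longrightarrow> finite (J y0)" and r: "\<And>y0. y0 \<in> C \<Longrightarrow> 0 < r y0" and
    s: "\<And>y0 i. y0 \<in> C \<Longrightarrow> i \<in> J y0 \<Longrightarrow> polynomial_function (s y0 i)"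
      "\<And>y0 i y. y0 \<in> C \<Longrightarrow> i \<in> J y0 \<Longrightarrow> y \<in> Y \<Longrightarrow> (y, s y0 i y) \<in> F" and
    g: "\<And>y0 i. y0 \<in> C \<Longrightarrow> i \<in> J y0 \<Longrightarrow> continuous_on (F \<inter> (cball y0 (r y0) \<times> UNIV)) (g y0 i)" and
    gs: "\<And>y0 y v. y0 \<in> C \<Longrightarrow> (y, v) \<in> F \<Longrightarrow> y \<in> cball y0 (r y0) \<Longrightarrow>
      v = (\<Sum>i\<in>J y0. g y0 i (y, v) *\<^sub>R s y0 i y)"
    unfolding good_def by blast+
  obtain N where N: "N \<subseteq> C" "finite N" "C \<subseteq> (\<Union>y0\<in>N. ball y0 (r y0))"
  proof (rule compactE_image[OF C(1), of C "\<lambda>y0. ball y0 (r y0)"])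
    show "C \<subseteq> (\<Union>c\<in>C. ball c (r c))" using r by fastforce
  qed auto
  \<comment> \<open>\<open>\<rho> y0\<close> vanishes outside the ball around \<open>y0\<close>, where nothing is known about \<open>g y0\<close>;
    dividing by the sum \<open>\<Sigma>\<close>, which is positive on \<open>C\<close>, makes these functions add up to \<open>1\<close>.\<close>
  define \<rho> where "\<rho> y0 y = max 0 (r y0 - dist y0 y)" for y0 y
  define \<Sigma> where "\<Sigma> y = (\<Sum>y0\<in>N. \<rho> y0 y)" for y
  have \<rho>_cont: "continuous_on A (\<rho> y0)" for A y0
    unfolding \<rho>_def by (intro continuous_intros)
  have \<Sigma>_pos: "\<Sigma> y > 0" if "y \<in> C" for y
  proof -
    obtain y0 where "y0 \<in> N" "y \<in> ball y0 (r y0)" using N(3) \<open>y \<in> C\<close> by blast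
    then show ?thesis unfolding \<Sigma>_def
      by (intro sum_pos2[OF N(2)]) (auto simp: \<rho>_def)
  qed
  define I where "I = Sigma N J"
  define \<sigma> where "\<sigma> = (\<lambda>(y0, i). s y0 i)"
  define \<gamma> where "\<gamma> = (\<lambda>(y0, i) w. \<rho> y0 (fst w) * g y0 i w / \<Sigma> (fst w))"
  show ?thesis
  proof (rule that)
    show "finite I" unfolding I_def using N J by auto
    show "polynomial_function (\<sigma> i)" if "i \<in> I" for i
      using that s(1) N(1) unfolding I_def \<sigma>_def by auto
    show "(y, \<sigma> i y) \<in> F" if "i \<in> I" "y \<in> Y" for i y
      using that s(2) N(1) unfolding I_def \<sigma>_def by auto
    show "continuous_on (F \<inter> (C \<times> UNIV)) (\<gamma> i)" if i: "i \<in> I" for i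
    proof -
      obtain y0 j where ij: "i = (y0, j)" "y0 \<in> N" "y0 \<in> C" "j \<in> J y0"
        using i N(1) unfolding I_def by auto
      let ?A = "F \<inter> (C \<times> UNIV)"
      let ?P = "cball y0 (r y0) \<times> (UNIV :: 'f set)" and ?Q = "(- ball y0 (r y0)) \<times> (UNIV :: 'f set)"
      have "continuous_on (?A \<inter> ?P) (\<lambda>w. \<rho> y0 (fst w) * g y0 j w)"
        by (intro continuous_on_mult continuous_on_compose2[OF \<rho>_cont[of UNIV]]
            continuous_on_subset[OF g[OF ij(3,4)]] continuous_intros) auto
      moreover have "continuous_on (?A \<inter> ?Q) (\<lambda>w. \<rho> y0 (fst w) * g y0 j w)"
        by (rule continuous_on_eq[of _ "\<lambda>_. 0"]) (auto simp: \<rho>_def)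
      moreover have "closedin (top_of_set ?A) (?A \<inter> ?P)" "closedin (top_of_set ?A) (?A \<inter> ?Q)"
        by (auto intro!: closedin_closed_Int closed_Times)
      moreover have "?A \<inter> ?P \<union> ?A \<inter> ?Q = ?A" by auto
      ultimately have "continuous_on ?A (\<lambda>w. \<rho> y0 (fst w) * g y0 j w)"
        using continuous_on_Un_local[of "?A \<inter> ?P" "?A \<inter> ?Q"] by simp
      moreover have "continuous_on ?A (\<lambda>w. \<Sigma> (fst w))"
        unfolding \<Sigma>_def
        by (intro continuous_on_sum continuous_on_compose2[OF \<rho>_cont[of UNIV]] continuous_intros) auto
      ultimately show ?thesis
        unfolding \<gamma>_def ij(1) prod.case using \<Sigma>_pos by (intro continuous_on_divide) fastforce+
    qed
    show "v = (\<Sum>i\<in>I. \<gamma> i (y, v) *\<^sub>R \<sigma> i y)" if yv: "(y, v) \<in> F" and y: "y \<in> C" for y v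
    proof -
      have part: "(\<Sum>j\<in>J y0. \<gamma> (y0, j) (y, v) *\<^sub>R \<sigma> (y0, j) y) = (\<rho> y0 y / \<Sigma> y) *\<^sub>R v" if "y0 \<in> N" for y0
      proof (cases "y \<in> cball y0 (r y0)")
        case True
        have "(\<rho> y0 y / \<Sigma> y) *\<^sub>R v = (\<rho> y0 y / \<Sigma> y) *\<^sub>R (\<Sum>j\<in>J y0. g y0 j (y, v) *\<^sub>R s y0 j y)"
          using gs[OF _ yv True] that N(1) by auto
        then show ?thesis
          by (simp add: \<gamma>_def \<sigma>_def scaleR_sum_right)
      next
        case False
        then have "\<rho> y0 y = 0" by (auto simp: \<rho>_def)
        then show ?thesis by (simp add: \<gamma>_def)
      qed
      have "(\<Sum>i\<in>I. \<gamma> i (y, v) *\<^sub>R \<sigma> i y) = (\<Sum>y0\<in>N. \<Sum>j\<in>J y0. \<gamma> (y0, j) (y, v) *\<^sub>R \<sigma> (y0, j) y)"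
        unfolding I_def using N J by (subst sum.Sigma) auto
      also have "\<dots> = (\<Sum>y0\<in>N. (\<rho> y0 y / \<Sigma> y) *\<^sub>R v)"
        using part by simp
      also have "\<dots> = (\<Sigma> y / \<Sigma> y) *\<^sub>R v"
        by (simp only: scaleR_sum_left[symmetric] sum_divide_distrib[symmetric] \<Sigma>_def)
      finally show ?thesis using \<Sigma>_pos[OF y] by simp
    qed
  qed
qed


section \<open>Quasi-sprays on subbundles\<close>

lemma smooth_map_continuous_on:
  assumes "smooth_map V W f"
  shows "continuous_on V f"
proof -
  have "continuous (at x within V) f" if "x \<in> V" for x
  proof -
    have "\<exists>U g. open U \<and> x \<in> U \<and> (\<forall>k. Ck_on k g U) \<and> (\<forall>z\<in>V \<inter> U. g z = f z)"
      using assms that unfolding smooth_map_def by (elim conjE) (rule bspec)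
    then obtain U g where g: "open U" "x \<in> U" "\<forall>k. Ck_on k g U" "\<forall>z\<in>V \<inter> U. g z = f z"
      by (elim exE conjE)
    have "Ck_on 0 g U" using g(3) by blast
    then have "continuous_on (V \<inter> U) g"
      by (auto intro: continuous_on_subset)
    then have "continuous_on (V \<inter> U) f"
      by (rule continuous_on_eq) (use g(4) in auto)
    moreover have "at x within V = at x within V \<inter> U"
      using g(1,2) by (intro at_within_nhd[of x U]) auto
    ultimately show ?thesis
      using that g(2) by (simp add: continuous_on_eq_continuous_within)
  qed
  then show ?thesis by (simp add: continuous_on_eq_continuous_within)
qed

text \<open>
A biregular isomorphism \<open>\<phi>\<close> onto an algebraic subbundle \<open>F\<close>, with inverse \<open>\<psi>\<close>, carries the spray to
  \<open>S = s V \<circ> \<psi>\<close> and the section \<open>\<tau> V\<close> to \<open>t\<close>. Domination is a statement about the Zariski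
  tangent space of a fibre of \<open>E\<close>, which is an arbitrary algebraic set in its ambient space; in
  \<open>F\<close> the fibres are linear, so it becomes a statement about derivatives of \<open>S\<close> along straight
  lines through \<open>t y\<close>.
\<close>

lemma quasi_spray_on_subbundle:
  fixes Y :: "'b::euclidean_space set" and E :: "('b, 'e::euclidean_space) vbundle"
  assumes spray: "quasi_spray TYPE('f::euclidean_space) Y E s \<tau>" and dom: "dominating Y E s \<tau>"
    and V: "V \<in> relatively_compact_open Y"
  obtains F :: "('b \<times> 'f::euclidean_space) set" and S t where "algebraic_subbundle Y F" "regular_map F Y S"
    "continuous_on V t" "\<And>y. y \<in> V \<Longrightarrow> (y, t y) \<in> F" "\<And>y. y \<in> V \<Longrightarrow> S (y, t y) = y"
    "\<And>y w. y \<in> V \<Longrightarrow> w \<in> tangent_space Y y \<Longrightarrow>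
       \<exists>l. (y, l) \<in> F \<and> ((\<lambda>r. S (y, t y + r *\<^sub>R l)) has_vector_derivative w) (at 0)"
proof -
  have VY: "V \<subseteq> Y"
    using V openin_imp_subset unfolding relatively_compact_open_def by blast
  let ?E = "vb_total E"
  have avb: "algebraic_vector_bundle TYPE('f) Y E" and s: "regular_map ?E Y (s V)"
    and \<tau>: "smooth_map V ?E (\<tau> V)" and s\<tau>: "\<And>y. y \<in> V \<Longrightarrow> s V (\<tau> V y) = y"
    and p\<tau>: "\<And>y. y \<in> V \<Longrightarrow> vb_proj E (\<tau> V y) = y"
    using spray V unfolding quasi_spray_def by blast+
  have zero: "\<And>y. y \<in> Y \<Longrightarrow> vb_zero E y \<in> vb_fibre E y"
    and add: "\<And>y u v. y \<in> Y \<Longrightarrow> u \<in> vb_fibre E y \<Longrightarrow> v \<in> vb_fibre E y \<Longrightarrow> vb_add E u v \<in> vb_fibre E y"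
    using avb unfolding algebraic_vector_bundle_def by blast+
  obtain F :: "('b \<times> 'f) set" and \<phi> where F: "algebraic_subbundle Y F" and bi: "biregular_map ?E F \<phi>"
    and fst_\<phi>: "\<And>u. u \<in> ?E \<Longrightarrow> fst (\<phi> u) = vb_proj E u"
    and \<phi>_zero: "\<And>y. y \<in> Y \<Longrightarrow> snd (\<phi> (vb_zero E y)) = 0"
    and \<phi>_add: "\<And>y u v. y \<in> Y \<Longrightarrow> u \<in> vb_fibre E y \<Longrightarrow> v \<in> vb_fibre E y \<Longrightarrow>
              snd (\<phi> (vb_add E u v)) = snd (\<phi> u) + snd (\<phi> v)"
    using avb unfolding algebraic_vector_bundle_def by blast
  obtain \<psi> where \<phi>: "regular_map ?E F \<phi>" and \<psi>: "regular_map F ?E \<psi>"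
    and \<psi>\<phi>: "\<And>u. u \<in> ?E \<Longrightarrow> \<psi> (\<phi> u) = u" and \<phi>\<psi>: "\<And>w. w \<in> F \<Longrightarrow> \<phi> (\<psi> w) = w"
    using bi unfolding biregular_map_def by blast
  have \<phi>F: "\<phi> u \<in> F" if "u \<in> ?E" for u using \<phi> that unfolding regular_map_def by blast
  have \<psi>E: "\<psi> w \<in> ?E" if "w \<in> F" for w using \<psi> that unfolding regular_map_def by blast
  have fibreE: "u \<in> ?E" "vb_proj E u = y" if "u \<in> vb_fibre E y" for u y
    using that unfolding vb_fibre_def by auto
  have \<tau>_fibre: "\<tau> V y \<in> vb_fibre E y" if "y \<in> V" for y
    using \<tau> p\<tau>[OF that] that unfolding vb_fibre_def smooth_map_def by auto
  define S where "S w = s V (\<psi> w)" for w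
  define t where "t y = snd (\<phi> (\<tau> V y))" for y
  have \<phi>\<tau>: "\<phi> (\<tau> V y) = (y, t y)" if "y \<in> V" for y
    using fst_\<phi> fibreE[OF \<tau>_fibre[OF that]] by (simp add: t_def prod_eq_iff)
  have \<psi>_fibre: "\<psi> (y, l) \<in> vb_fibre E y" if "(y, l) \<in> F" for y l
    using \<psi>E[OF that] fst_\<phi>[OF \<psi>E[OF that]] \<phi>\<psi>[OF that] by (simp add: vb_fibre_def)
  have S_reg: "regular_map F Y S"
    unfolding S_def by (rule regular_map_compose[OF s \<psi>])
  have t_cont: "continuous_on V t"
  proof -
    have "continuous_on V (\<lambda>y. \<phi> (\<tau> V y))"
      by (rule continuous_on_compose2[OF regular_map_continuous_on[OF \<phi>] smooth_map_continuous_on[OF \<tau>]])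
        (use \<tau> in \<open>auto simp: smooth_map_def\<close>)
    then show ?thesis unfolding t_def by (rule continuous_on_snd)
  qed
  have tF: "(y, t y) \<in> F" if "y \<in> V" for y
    using \<phi>F fibreE(1)[OF \<tau>_fibre[OF that]] \<phi>\<tau>[OF that] by metis
  have St: "S (y, t y) = y" if "y \<in> V" for y
    using \<phi>\<tau>[OF that] \<psi>\<phi>[OF fibreE(1)[OF \<tau>_fibre[OF that]]] s\<tau>[OF that] by (simp add: S_def)
  have sub: "subspace {v. (y, v) \<in> F}" if "y \<in> Y" for y
    using F that unfolding algebraic_subbundle_def by blast
  have "\<exists>l. (y, l) \<in> F \<and> ((\<lambda>r. S (y, t y + r *\<^sub>R l)) has_vector_derivative w) (at 0)"
    if y: "y \<in> V" and w: "w \<in> tangent_space Y y" for y w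
  proof -
    have yY: "y \<in> Y" using y VY by blast
    let ?A = "vb_fibre E y" and ?o = "vb_zero E y" and ?L = "{v. (y, v) \<in> F}"
    let ?f = "\<lambda>v. s V (vb_add E v (\<tau> V y))"
    have oE: "?o \<in> ?E" using fibreE zero[OF yY] by blast
    have \<phi>o: "\<phi> ?o = (y, 0)"
      using fst_\<phi>[OF oE] \<phi>_zero[OF yY] fibreE(2)[OF zero[OF yY]] by (simp add: prod_eq_iff)
    \<comment> \<open>In the coordinates given by \<open>\<phi>\<close>, translation by \<open>\<tau> V y\<close> is translation by \<open>t y\<close>.\<close>
    have transl: "?f v = S (y, t y + snd (\<phi> v))" if "v \<in> ?A" for v
    proof -
      have a: "vb_add E v (\<tau> V y) \<in> ?A" by (rule add[OF yY that \<tau>_fibre[OF y]])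
      then have "\<phi> (vb_add E v (\<tau> V y)) = (y, t y + snd (\<phi> v))"
        using fst_\<phi>[OF fibreE(1)[OF a]] fibreE(2)[OF a] \<phi>_add[OF yY that \<tau>_fibre[OF y]]
        by (simp add: prod_eq_iff t_def)
      then show ?thesis
        using \<psi>\<phi>[OF fibreE(1)[OF a]] unfolding S_def by metis
    qed
    have "?f ?o = y" using transl[OF zero[OF yY]] \<phi>o St[OF y] by simp
    then obtain f' where f': "(?f has_derivative f') (at ?o within ?A)"
      "f' ` tangent_space ?A ?o = tangent_space Y y"
      using dom V y unfolding dominating_def submersion_at_def by metis
    then have "w \<in> f' ` tangent_space ?A ?o" using w by simp
    then obtain u where u: "u \<in> tangent_space ?A ?o" "f' u = w"
      by (elim imageE) metis
    obtain \<Omega> \<phi>x where \<phi>x: "open \<Omega>" "?E \<subseteq> \<Omega>" "regular_map \<Omega> UNIV \<phi>x" "\<And>v. v \<in> ?E \<Longrightarrow> \<phi>x v = \<phi> v"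
      using regular_map_open_extension[OF \<phi>] by metis
    obtain \<Omega>' \<psi>x where \<psi>x: "open \<Omega>'" "F \<subseteq> \<Omega>'" "regular_map \<Omega>' UNIV \<psi>x" "\<And>v. v \<in> F \<Longrightarrow> \<psi>x v = \<psi> v"
      using regular_map_open_extension[OF \<psi>] by metis
    have o\<Omega>: "?o \<in> \<Omega>" using oE \<phi>x(2) by blast
    have y0F: "(y, 0) \<in> F" using \<phi>F[OF oE] \<phi>o by simp
    obtain \<phi>' where \<phi>': "(\<phi>x has_derivative \<phi>') (at ?o)"
      using regular_map_C1[OF \<phi>x(3,1)] o\<Omega> by metis
    obtain \<psi>' where \<psi>': "(\<psi>x has_derivative \<psi>') (at (y, 0))"
      using regular_map_C1[OF \<psi>x(3,1)] y0F \<psi>x(2) by (metis subsetD)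
    have AE: "?A \<subseteq> ?E" using fibreE(1) by blast
    have \<phi>A: "\<exists>l\<in>?L. \<phi>x v = (y, l)" if "v \<in> ?A" for v
    proof -
      have "\<phi> v = (y, snd (\<phi> v))" using fst_\<phi>[OF fibreE(1)[OF that]] fibreE(2)[OF that] by (simp add: prod_eq_iff)
      then show ?thesis using \<phi>F[OF fibreE(1)[OF that]] \<phi>x(4)[OF fibreE(1)[OF that]] by (metis mem_Collect_eq)
    qed
    \<comment> \<open>The differential of \<open>\<phi>\<close> maps the tangent space of the fibre into \<open>{0} \<times> ?L\<close>.\<close>
    have "\<phi>' u \<in> {0} \<times> ?L"
    proof -
      have subM: "subspace ({0} \<times> ?L)" by (intro subspace_Times sub[OF yY]) simp
      \<comment> \<open>The component \<open>z\<close> of \<open>\<phi>' u\<close> orthogonal to this subspace vanishes, because the function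
        \<open>z \<bullet> (\<phi> - (y, 0))\<close> vanishes on the fibre and so has derivative \<open>0\<close> along \<open>u\<close>.\<close>
      obtain a z where az: "a \<in> span ({0} \<times> ?L)" "\<And>m. m \<in> span ({0} \<times> ?L) \<Longrightarrow> orthogonal z m"
        "\<phi>' u = a + z"
        using orthogonal_subspace_decomp_exists by metis
      let ?R = "\<lambda>v. z \<bullet> (\<phi>x v + - (y, 0))"
      have const: "regular_map \<Omega> UNIV (\<lambda>v. c)" for c :: "'b \<times> 'f"
        by (rule regular_map_polynomial) auto
      have "regular_map \<Omega> UNIV ?R"
        using regular_function_inner[OF const[of z] regular_map_add[OF \<phi>x(3) const[of "- (y, 0)"]]]
        by (simp add: regular_map_def)
      moreover have "(?R has_derivative (\<lambda>h. z \<bullet> (\<phi>' h + 0))) (at ?o)"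
        by (intro has_derivative_inner_right has_derivative_add \<phi>' has_derivative_const)
      moreover have "?R v = 0" if v: "v \<in> ?A" for v
      proof -
        obtain l where l: "l \<in> ?L" "\<phi>x v = (y, l)" using \<phi>A[OF v] by blast
        then have "orthogonal z (0, l)" by (intro az(2) span_base) auto
        then show ?thesis using l by (simp add: orthogonal_def)
      qed
      ultimately have "z \<bullet> (\<phi>' u + 0) = 0"
        using derivative_zero_on_tangent_space[OF _ \<phi>x(1) _ zero[OF yY] _ _ u(1)] AE \<phi>x(2) by blast
      moreover have "z \<bullet> a = 0" using az(1,2) by (simp add: orthogonal_def)
      ultimately have "z = 0" using az(3) by (simp add: inner_add_right)
      have "a \<in> {0} \<times> ?L" using az(1) span_minimal[OF subset_refl subM] by blast
      then show ?thesis using az(3) \<open>z = 0\<close> by simp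
    qed
    then obtain l where l: "(y, l) \<in> F" "\<phi>' u = (0, l)" by auto
    \<comment> \<open>Since \<open>\<psi> \<circ> \<phi>\<close> is the identity on the fibre, \<open>u\<close> is the image of \<open>(0, l)\<close>.\<close>
    have \<psi>'l: "\<psi>' (0, l) = u"
    proof -
      let ?\<Omega> = "\<Omega> \<inter> \<phi>x -` \<Omega>'"
      let ?R = "\<lambda>v. \<psi>x (\<phi>x v) + (- 1) *\<^sub>R v"
      have op: "open ?\<Omega>"
        using continuous_open_preimage[OF regular_map_continuous_on[OF \<phi>x(3)] \<phi>x(1) \<psi>x(1)] .
      have A\<Omega>: "?A \<subseteq> ?\<Omega>"
        using AE \<phi>x(2,4) \<phi>F \<psi>x(2) by fastforce
      have "regular_map ?\<Omega> \<Omega>' \<phi>x"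
        using regular_map_subset[OF \<phi>x(3), of ?\<Omega> UNIV] regular_map_UNIV[of ?\<Omega> \<Omega>' \<phi>x] by auto
      moreover have "regular_map ?\<Omega> UNIV (\<lambda>v. (- 1) *\<^sub>R v)"
        by (intro regular_map_polynomial polynomial_function_cmul) auto
      ultimately have "regular_map ?\<Omega> UNIV ?R"
        by (intro regular_map_add regular_map_compose[OF \<psi>x(3)])
      moreover have "(?R has_derivative (\<lambda>h. \<psi>' (\<phi>' h) + (- 1) *\<^sub>R h)) (at ?o)"
      proof (intro has_derivative_add has_derivative_scaleR_right has_derivative_ident)
        have "(\<psi>x has_derivative \<psi>') (at (\<phi>x ?o))" using \<psi>' \<phi>o \<phi>x(4)[OF oE] by simp
        then show "((\<lambda>v. \<psi>x (\<phi>x v)) has_derivative (\<lambda>h. \<psi>' (\<phi>' h))) (at ?o)"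
          by (rule has_derivative_compose[OF \<phi>'])
      qed
      moreover have "?R v = 0" if "v \<in> ?A" for v
        using \<phi>x(4) \<psi>x(4) \<phi>F \<psi>\<phi> AE that by (simp add: subset_iff)
      ultimately have "\<psi>' (\<phi>' u) + (- 1) *\<^sub>R u = 0"
        using derivative_zero_on_tangent_space[OF _ op A\<Omega> zero[OF yY] _ _ u(1)] by blast
      then show ?thesis using l(2) by simp
    qed
    \<comment> \<open>Hence \<open>u\<close> is the velocity of a curve in the fibre, on which the differential is determined.\<close>
    let ?c = "\<lambda>r. \<psi>x (y, r *\<^sub>R l)"
    have rl: "(y, r *\<^sub>R l) \<in> F" for r
      using subspace_mul[OF sub[OF yY]] l(1) by simp
    have cA: "?c r \<in> ?A" for r
      using \<psi>x(4)[OF rl] \<psi>_fibre[OF rl] by simp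
    have c0: "?c 0 = ?o" using \<psi>x(4)[OF y0F] \<psi>\<phi>[OF oE] \<phi>o by simp
    have "(?c has_derivative (\<lambda>r. \<psi>' (0, r *\<^sub>R l))) (at 0)"
    proof (rule has_derivative_compose[where f = "\<lambda>r. (y, r *\<^sub>R l)"])
      show "((\<lambda>r. (y, r *\<^sub>R l)) has_derivative (\<lambda>r. (0, r *\<^sub>R l))) (at 0)"
        by (intro has_derivative_Pair has_derivative_const has_derivative_scaleR_left has_derivative_ident)
      show "(\<psi>x has_derivative \<psi>') (at (y, 0 *\<^sub>R l))" using \<psi>' by simp
    qed
    moreover have "(?f has_derivative f') (at (?c 0) within range ?c)"
      using f'(1) cA c0 by (auto intro: has_derivative_subset)
    ultimately have "((\<lambda>r. ?f (?c r)) has_derivative (\<lambda>r. f' (\<psi>' (0, r *\<^sub>R l)))) (at 0)"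
      by (rule has_derivative_in_compose)
    moreover have "?f (?c r) = S (y, t y + r *\<^sub>R l)" for r
      using transl[OF cA[of r]] \<psi>x(4)[OF rl] \<phi>\<psi>[OF rl] by simp
    moreover have "f' (\<psi>' (0, r *\<^sub>R l)) = r *\<^sub>R w" for r
    proof -
      have "\<psi>' (r *\<^sub>R (0, l)) = r *\<^sub>R u"
        using linear_scale[OF has_derivative_linear[OF \<psi>'], of r "(0, l)"] \<psi>'l by simp
      then show ?thesis
        using linear_scale[OF has_derivative_linear[OF f'(1)], of r u] u(2) by simp
    qed
    ultimately show ?thesis
      using l(1) by (auto simp: has_vector_derivative_def)
  qed
  then show ?thesis
    using that[OF F S_reg t_cont tF St] by blast
qed


section \<open>Contraction by a gradient step\<close>

text \<open>
The operator \<open>H w = (\<Sum>i\<in>I. (a i \<bullet> w) *\<^sub>R a i)\<close> is symmetric and positive semidefinite, with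
  kernel orthogonal to the span of the \<open>a i\<close> and with norm at most the sum of the
  \<open>(norm (a i))\<^sup>2\<close>. So \<open>w \<mapsto> w - c *\<^sub>R H w\<close>, a gradient step for \<open>(w \<bullet> H w) / 2\<close>, shrinks every
  nonzero vector of the span as soon as \<open>c\<close> is at most the inverse of that sum.
\<close>

lemma gradient_step_contracts:
  fixes a :: "'i \<Rightarrow> 'b::euclidean_space"
  assumes I: "finite I" and w: "w \<in> span (a ` I)" "w \<noteq> 0"
    and c: "0 < c" "c * (\<Sum>i\<in>I. (norm (a i))\<^sup>2) \<le> 1"
  shows "norm (w - c *\<^sub>R (\<Sum>i\<in>I. (a i \<bullet> w) *\<^sub>R a i)) < norm w"
proof -
  let ?H = "\<Sum>i\<in>I. (a i \<bullet> w) *\<^sub>R a i"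
  define q where "q = (\<Sum>i\<in>I. (a i \<bullet> w)\<^sup>2)"
  have "q > 0"
  proof (rule ccontr)
    assume "\<not> q > 0"
    moreover have "q \<ge> 0" unfolding q_def by (intro sum_nonneg) simp
    ultimately have "q = 0" by simp
    then have "\<forall>i\<in>I. a i \<bullet> w = 0"
      unfolding q_def using I by (simp add: sum_nonneg_eq_0_iff)
    then have "orthogonal w w"
      by (intro orthogonal_to_span[OF w(1)]) (auto simp: orthogonal_def inner_commute)
    then show False using w(2) by (simp add: orthogonal_def)
  qed
  have wH: "w \<bullet> ?H = q"
    unfolding q_def by (simp add: inner_sum_right power2_eq_square inner_commute)
  have "norm ?H \<le> (\<Sum>i\<in>I. \<bar>a i \<bullet> w\<bar> * norm (a i))"
    by (rule sum_norm_le) simp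
  then have "(norm ?H)\<^sup>2 \<le> (\<Sum>i\<in>I. \<bar>a i \<bullet> w\<bar> * norm (a i))\<^sup>2"
    by (intro power_mono) auto
  also have "\<dots> \<le> q * (\<Sum>i\<in>I. (norm (a i))\<^sup>2)"
    using Cauchy_Schwarz_ineq_sum[of "\<lambda>i. \<bar>a i \<bullet> w\<bar>" "\<lambda>i. norm (a i)" I] by (simp add: q_def)
  finally have "c * (norm ?H)\<^sup>2 \<le> c * (q * (\<Sum>i\<in>I. (norm (a i))\<^sup>2))"
    using c(1) by (intro mult_left_mono) auto
  also have "\<dots> = q * (c * (\<Sum>i\<in>I. (norm (a i))\<^sup>2))" by (simp add: algebra_simps)
  also have "\<dots> \<le> q * 1" using c(2) \<open>q > 0\<close> by (intro mult_left_mono) auto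
  finally have H: "c * (norm ?H)\<^sup>2 \<le> q" by simp
  have "(norm (w - c *\<^sub>R ?H))\<^sup>2 = (norm w)\<^sup>2 - 2 * c * q + c * (c * (norm ?H)\<^sup>2)"
    using wH unfolding power2_norm_eq_inner
    by (simp add: inner_diff_left inner_diff_right inner_commute algebra_simps power2_eq_square)
  also have "\<dots> \<le> (norm w)\<^sup>2 - 2 * c * q + c * q"
    using mult_left_mono[OF H, of c] c(1) by simp
  also have "\<dots> < (norm w)\<^sup>2" using c(1) \<open>q > 0\<close> by simp
  finally show ?thesis by (rule power2_less_imp_less) simp
qed

text \<open>
A polynomial that vanishes on \<open>Y\<close> has zero increment along every secant, and strict
  differentiability passes this on to its derivative in the limit. Both end points move, so the
  tangent space at the limit is reached from secants based at other points.
\<close>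

lemma secant_limit_in_tangent_space:
  fixes Y :: "'b::euclidean_space set"
  assumes yz: "\<And>n::nat. y n \<in> Y" "\<And>n. z n \<in> Y" "\<And>n. y n \<noteq> z n"
    and lim: "y \<longlonglongrightarrow> a" "z \<longlonglongrightarrow> a" "(\<lambda>n. sgn (z n - y n)) \<longlonglongrightarrow> w"
  shows "w \<in> tangent_space Y a"
proof -
  have "gradient P a \<bullet> w = 0" if P: "real_polynomial_function P" "\<forall>z\<in>Y. P z = 0" for P
  proof -
    obtain D where D: "\<And>x. (P has_derivative D x) (at x)" "\<And>v. continuous_on UNIV (\<lambda>x. D x v)"
      using real_polynomial_function_C1[OF P(1)] by metis
    have lin: "linear (D a)" using D(1) has_derivative_linear by blast
    have lim_D: "(\<lambda>n. D a (sgn (z n - y n))) \<longlonglongrightarrow> D a w"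
      using bounded_linear.tendsto[OF has_derivative_bounded_linear[OF D(1)] lim(3)] .
    have "\<bar>D a w\<bar> \<le> \<eta>" if "\<eta> > 0" for \<eta>
    proof -
      obtain r where r: "0 < r" "\<And>x y. x \<in> ball a r \<Longrightarrow> y \<in> ball a r \<Longrightarrow>
          norm (P y - P x - D a (y - x)) \<le> \<eta> * norm (y - x)"
        using C1_strictly_differentiable[of UNIV a P D, OF open_UNIV UNIV_I D \<open>\<eta> > 0\<close>] by metis
      have "eventually (\<lambda>n. y n \<in> ball a r) sequentially" "eventually (\<lambda>n. z n \<in> ball a r) sequentially"
        using lim(1,2) r(1) by (auto simp: tendsto_iff dist_commute)
      then have "eventually (\<lambda>n. norm (D a (sgn (z n - y n))) \<le> \<eta>) sequentially"
      proof eventually_elim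
        case (elim n)
        have "\<bar>D a (z n - y n)\<bar> \<le> \<eta> * norm (z n - y n)"
          using r(2)[OF elim] P(2) yz(1,2) by simp
        moreover have "D a (sgn (z n - y n)) = D a (z n - y n) / norm (z n - y n)"
          by (simp add: sgn_div_norm linear_scale[OF lin] divide_inverse mult.commute)
        ultimately show ?case
          using yz(3)[of n] by (simp add: abs_divide pos_divide_le_eq)
      qed
      then have "norm (D a w) \<le> \<eta>"
        by (rule Lim_norm_ubound[OF sequentially_bot lim_D])
      then show ?thesis by simp
    qed
    then have "D a w = 0" using field_le_epsilon[of "\<bar>D a w\<bar>" 0] by simp
    then show ?thesis using gradient_inner[OF D(1)] by simp
  qed
  then show ?thesis unfolding tangent_space_def by blast
qed

text \<open>
Given \<open>z\<close> near \<open>y\<close>, the equation \<open>S (y, v) = z\<close> need not be solved: it is enough to find \<open>v\<close>,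
  continuous in \<open>y\<close> and \<open>z\<close>, such that \<open>S (y, v)\<close> is nearer to \<open>z\<close> than \<open>y\<close> is, by a fixed
  factor. With \<open>a i y\<close> the derivative of \<open>S (y, _)\<close> at \<open>t y\<close> in the direction \<open>\<sigma> i y\<close>, move
  from \<open>t y\<close> along the \<open>\<sigma> i y\<close> with coefficients proportional to \<open>a i y \<bullet> (z - y)\<close>. To first
  order this is the step of \<open>gradient_step_contracts\<close> applied to \<open>z - y\<close>. The vectors \<open>a i y\<close>
  span a space that contains the tangent space of \<open>Y\<close> by domination, and \<open>z - y\<close> is almost
  tangent by \<open>secant_limit_in_tangent_space\<close>. Uniformity in \<open>y\<close> and \<open>z\<close> is a compactness
  argument.
\<close>

lemma spray_gradient_step:
  fixes Y :: "'b::euclidean_space set" and F :: "('b \<times> 'f::euclidean_space) set"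
    and \<sigma> :: "'i \<Rightarrow> 'b \<Rightarrow> 'f"
  assumes C: "compact C" "C \<subseteq> Y" and S: "regular_map F Y S"
    and t: "continuous_on C t" "\<And>y. y \<in> C \<Longrightarrow> (y, t y) \<in> F" "\<And>y. y \<in> C \<Longrightarrow> S (y, t y) = y"
    and fibre: "\<And>y. y \<in> C \<Longrightarrow> subspace {v. (y, v) \<in> F}"
    and I: "finite I" and \<sigma>: "\<And>i. i \<in> I \<Longrightarrow> continuous_on C (\<sigma> i)"
      "\<And>i y. i \<in> I \<Longrightarrow> y \<in> C \<Longrightarrow> (y, \<sigma> i y) \<in> F"
    and span: "\<And>y v. y \<in> C \<Longrightarrow> (y, v) \<in> F \<Longrightarrow> v \<in> span ((\<lambda>i. \<sigma> i y) ` I)"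
    and dom: "\<And>y w. y \<in> C \<Longrightarrow> w \<in> tangent_space Y y \<Longrightarrow>
       \<exists>l. (y, l) \<in> F \<and> ((\<lambda>r. S (y, t y + r *\<^sub>R l)) has_vector_derivative w) (at 0)"
  obtains b :: "'i \<Rightarrow> 'b \<Rightarrow> 'b" and \<epsilon> \<kappa> where "0 < \<epsilon>" "0 \<le> \<kappa>" "\<kappa> < 1"
    "\<And>i. i \<in> I \<Longrightarrow> continuous_on C (b i)"
    "\<And>y z. y \<in> C \<Longrightarrow> z \<in> Y \<Longrightarrow> norm (z - y) \<le> \<epsilon> \<Longrightarrow>
       norm (S (y, t y + (\<Sum>i\<in>I. (b i y \<bullet> (z - y)) *\<^sub>R \<sigma> i y)) - z) \<le> \<kappa> * norm (z - y)"
proof -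
  obtain \<Omega> Sx where Sx: "open \<Omega>" "F \<subseteq> \<Omega>" "regular_map \<Omega> UNIV Sx" "\<And>w. w \<in> F \<Longrightarrow> Sx w = S w"
    using regular_map_open_extension[OF S] by metis
  obtain D where D: "\<And>p. p \<in> \<Omega> \<Longrightarrow> (Sx has_derivative D p) (at p)"
    "\<And>v. continuous_on \<Omega> (\<lambda>p. D p v)"
    using regular_map_C1[OF Sx(3,1)] by metis
  have p\<Omega>: "(y, t y) \<in> \<Omega>" if "y \<in> C" for y using t(2)[OF that] Sx(2) by blast
  have lin: "linear (D (y, t y))" if "y \<in> C" for y
    using D(1)[OF p\<Omega>[OF that]] has_derivative_linear by blast
  define a where "a i y = D (y, t y) (0, \<sigma> i y)" for i y
  have a_cont: "continuous_on C (a i)" if "i \<in> I" for i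
  proof -
    have eq: "a i y = (\<Sum>e\<in>Basis. ((0, \<sigma> i y) \<bullet> e) *\<^sub>R D (y, t y) e)" if "y \<in> C" for y
    proof -
      have "a i y = D (y, t y) (\<Sum>e\<in>Basis. ((0, \<sigma> i y) \<bullet> e) *\<^sub>R e)"
        unfolding a_def by (simp add: euclidean_representation)
      then show ?thesis by (simp only: linear_sum[OF lin[OF that]] linear_scale[OF lin[OF that]])
    qed
    have "continuous_on C (\<lambda>y. D (y, t y) e)" for e
      by (rule continuous_on_compose2[OF D(2)]) (use p\<Omega> in \<open>auto intro!: continuous_intros t(1)\<close>)
    then have "continuous_on C (\<lambda>y. \<Sum>e\<in>Basis. ((0, \<sigma> i y) \<bullet> e) *\<^sub>R D (y, t y) e)"
      by (intro continuous_intros \<sigma>(1)[OF that])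
    then show ?thesis using eq by (simp cong: continuous_on_cong)
  qed
  have a_span: "w \<in> span ((\<lambda>i. a i y) ` I)" if y: "y \<in> C" and w: "w \<in> tangent_space Y y" for y w
  proof -
    obtain l where l: "(y, l) \<in> F" "((\<lambda>r. S (y, t y + r *\<^sub>R l)) has_vector_derivative w) (at 0)"
      using dom[OF y w] by blast
    have rl: "(y, t y + r *\<^sub>R l) \<in> F" for r
      using subspace_add[OF fibre[OF y]] subspace_mul[OF fibre[OF y]] t(2)[OF y] l(1) by simp
    have "((\<lambda>r. Sx (y, t y + r *\<^sub>R l)) has_derivative (\<lambda>r. D (y, t y) (0, r *\<^sub>R l))) (at 0)"
    proof (rule has_derivative_compose[where f = "\<lambda>r. (y, t y + r *\<^sub>R l)"])
      have "((\<lambda>r. (y, t y + r *\<^sub>R l)) has_derivative (\<lambda>r. (0, 0 + r *\<^sub>R l))) (at 0)"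
        by (intro has_derivative_Pair has_derivative_const has_derivative_add
            has_derivative_scaleR_left has_derivative_ident)
      then show "((\<lambda>r. (y, t y + r *\<^sub>R l)) has_derivative (\<lambda>r. (0, r *\<^sub>R l))) (at 0)" by simp
      show "(Sx has_derivative D (y, t y)) (at (y, t y + 0 *\<^sub>R l))" using D(1)[OF p\<Omega>[OF y]] by simp
    qed
    then have "((\<lambda>r. S (y, t y + r *\<^sub>R l)) has_derivative (\<lambda>r. D (y, t y) (0, r *\<^sub>R l))) (at 0)"
      using Sx(4)[OF rl] by simp
    then have "(\<lambda>r. r *\<^sub>R w) = (\<lambda>r. D (y, t y) (0, r *\<^sub>R l))"
      using l(2) unfolding has_vector_derivative_def by (rule has_derivative_unique[rotated])
    then have "1 *\<^sub>R w = D (y, t y) (0, 1 *\<^sub>R l)" by metis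
    then have wD: "w = D (y, t y) (0, l)" by simp
    have linl: "linear (\<lambda>v. D (y, t y) (0, v))"
      using linear_compose[OF _ lin[OF y], of "\<lambda>v. (0, v)"] by (simp add: o_def linear_iff)
    then have "D (y, t y) (0, l) \<in> span ((\<lambda>v. D (y, t y) (0, v)) ` (\<lambda>i. \<sigma> i y) ` I)"
      using span[OF y l(1)] by (metis linear_span_image imageI)
    then show ?thesis unfolding wD a_def by (simp add: image_image)
  qed
  have "bounded ((\<lambda>y. \<Sum>i\<in>I. (norm (a i y))\<^sup>2) ` C)"
    by (intro compact_imp_bounded compact_continuous_image continuous_intros a_cont C)
  then obtain M where M: "M > 0" "\<And>y. y \<in> C \<Longrightarrow> (\<Sum>i\<in>I. (norm (a i y))\<^sup>2) \<le> M"
    unfolding bounded_pos by fastforce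
  \<comment> \<open>One step size for all of \<open>C\<close>, small enough for \<open>gradient_step_contracts\<close>.\<close>
  define b where "b i y = (1 / M) *\<^sub>R a i y" for i y
  let ?v = "\<lambda>y w. \<Sum>i\<in>I. (b i y \<bullet> w) *\<^sub>R \<sigma> i y"
  have b_cont: "continuous_on C (b i)" if "i \<in> I" for i
    unfolding b_def by (intro continuous_intros a_cont that)
  have vF: "(y, ?v y w) \<in> F" if "y \<in> C" for y w
    using subspace_sum[OF fibre[OF that], of I "\<lambda>i. (b i y \<bullet> w) *\<^sub>R \<sigma> i y"]
      subspace_mul[OF fibre[OF that]] \<sigma>(2) that by simp
  have tvF: "(y, t y + ?v y w) \<in> F" if "y \<in> C" for y w
    using subspace_add[OF fibre[OF that]] vF[OF that] t(2)[OF that] by simp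
  \<comment> \<open>If no radius and factor work, a sequence of counterexamples with radius tending to \<open>0\<close> and
    factor tending to \<open>1\<close> has a limit point \<open>y0\<close> and a limit direction \<open>w0\<close>, which is tangent. Along
    \<open>w0\<close> the linearised step would not contract.\<close>
  define contracts where "contracts n y z \<longleftrightarrow>
      norm (S (y, t y + ?v y (z - y)) - z) \<le> (1 - 1 / (real n + 1)) * norm (z - y)" for n :: nat and y z
  have "\<exists>n. \<forall>y\<in>C. \<forall>z\<in>Y. norm (z - y) \<le> 1 / (real n + 1) \<longrightarrow> contracts n y z"
  proof (rule ccontr)
    assume "\<not> ?thesis"
    then have "\<forall>n. \<exists>y z. y \<in> C \<and> z \<in> Y \<and> norm (z - y) \<le> 1 / (real n + 1) \<and> \<not> contracts n y z"
      by blast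
    then obtain y z where yz: "\<And>n. y n \<in> C" "\<And>n. z n \<in> Y" "\<And>n. norm (z n - y n) \<le> 1 / (real n + 1)"
      and "\<And>n. \<not> contracts n (y n) (z n)"
      by metis
    then have far: "norm (S (y n, t (y n) + ?v (y n) (z n - y n)) - z n) > (1 - 1 / (real n + 1)) * norm (z n - y n)" for n
      unfolding contracts_def by (simp only: not_le)
    have ne: "y n \<noteq> z n" for n
      using far[of n] t(3)[OF yz(1)[of n]] by (cases "y n = z n") auto
    have ne': "z n \<noteq> y n" for n using ne[of n] by simp
    have in_compact: "\<forall>n. (y n, sgn (z n - y n)) \<in> C \<times> sphere 0 1"
      using yz(1) ne' by (simp add: norm_sgn)
    have "seq_compact (C \<times> sphere (0::'b) 1)"
      by (intro compact_imp_seq_compact compact_Times C compact_sphere)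
    then obtain p r where pr: "p \<in> C \<times> sphere 0 1" "strict_mono (r :: nat \<Rightarrow> nat)"
      "((\<lambda>n. (y n, sgn (z n - y n))) \<circ> r) \<longlonglongrightarrow> p"
      using in_compact by (rule seq_compactE)
    obtain y0 w0 where p: "p = (y0, w0)" by (cases p)
    have y0: "y0 \<in> C" and w0: "norm w0 = 1" using pr(1) p by auto
    define y' where "y' = (\<lambda>n. y (r n))"
    define z' where "z' = (\<lambda>n. z (r n))"
    define w' where "w' = (\<lambda>n. sgn (z' n - y' n))"
    define \<nu> where "\<nu> n = norm (z' n - y' n)" for n
    have lim_y: "y' \<longlonglongrightarrow> y0" and lim_w: "w' \<longlonglongrightarrow> w0"
      using tendsto_fst[OF pr(3)] tendsto_snd[OF pr(3)]
      by (simp_all add: p y'_def z'_def w'_def o_def)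
    have lim1: "(\<lambda>n. 1 / (real (r n) + 1)) \<longlonglongrightarrow> 0"
      using LIMSEQ_subseq_LIMSEQ[OF LIMSEQ_inverse_real_of_nat pr(2)]
      by (simp add: o_def inverse_eq_divide add.commute)
    have lim_\<nu>: "\<nu> \<longlonglongrightarrow> 0"
    proof (rule tendsto_sandwich[OF _ _ tendsto_const lim1])
      show "\<forall>\<^sub>F n in sequentially. 0 \<le> \<nu> n" by (simp add: \<nu>_def)
      show "\<forall>\<^sub>F n in sequentially. \<nu> n \<le> 1 / (real (r n) + 1)"
        using yz(3) by (simp add: \<nu>_def y'_def z'_def)
    qed
    have \<nu>_pos: "\<nu> n > 0" for n using ne' by (simp add: \<nu>_def y'_def z'_def)
    have zy: "z' n - y' n = \<nu> n *\<^sub>R w' n" for n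
      using \<nu>_pos[of n] by (simp add: \<nu>_def w'_def sgn_div_norm)
    have "(\<lambda>n. y' n + (z' n - y' n)) \<longlonglongrightarrow> y0 + 0 *\<^sub>R w0"
      unfolding zy by (intro tendsto_intros lim_y lim_\<nu> lim_w)
    then have lim_z: "z' \<longlonglongrightarrow> y0" by simp
    have "w0 \<in> tangent_space Y y0"
      using secant_limit_in_tangent_space[of y' Y z' y0 w0] lim_y lim_z lim_w yz(1,2) ne C(2)
      unfolding w'_def y'_def z'_def by blast
    then have "norm (w0 - (1 / M) *\<^sub>R (\<Sum>i\<in>I. (a i y0 \<bullet> w0) *\<^sub>R a i y0)) < norm w0"
      using M w0 y0 a_span[OF y0]
      by (intro gradient_step_contracts[OF I]) (auto simp: divide_simps)
    define u where "u n = ?v (y' n) (w' n)" for n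
    define u0 where "u0 = ?v y0 w0"
    have yC: "y' n \<in> C" for n by (simp add: y'_def yz(1))
    have lim_C: "(\<lambda>n. h (y' n)) \<longlonglongrightarrow> h y0" if "continuous_on C h" for h :: "'b \<Rightarrow> 'x::topological_space"
      using continuous_on_tendsto_compose[OF that lim_y y0] yC by simp
    have lim_u: "u \<longlonglongrightarrow> u0"
      unfolding u_def u0_def by (intro tendsto_intros lim_C b_cont \<sigma>(1) lim_w)
    have v_scale: "?v (y' n) (z' n - y' n) = \<nu> n *\<^sub>R u n" for n
      unfolding zy u_def by (simp add: scaleR_sum_right)
    have lim_p: "(\<lambda>n. (y' n, t (y' n))) \<longlonglongrightarrow> (y0, t y0)"
      by (intro tendsto_intros lim_y lim_C t(1))
    have "(\<lambda>n. (y' n, t (y' n) + \<nu> n *\<^sub>R u n)) \<longlonglongrightarrow> (y0, t y0 + 0 *\<^sub>R u0)"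
      by (intro tendsto_intros lim_y lim_C t(1) lim_u lim_\<nu>)
    then have lim_q: "(\<lambda>n. (y' n, t (y' n) + \<nu> n *\<^sub>R u n)) \<longlonglongrightarrow> (y0, t y0)" by simp
    let ?D = "D (y0, t y0)"
    have Du0: "?D (0, u0) = (1 / M) *\<^sub>R (\<Sum>i\<in>I. (a i y0 \<bullet> w0) *\<^sub>R a i y0)"
    proof -
      have "(0, u0) = (\<Sum>i\<in>I. (b i y0 \<bullet> w0) *\<^sub>R (0::'b, \<sigma> i y0))"
        unfolding u0_def by (simp add: prod_eq_iff fst_sum snd_sum)
      then have "?D (0, u0) = (\<Sum>i\<in>I. (b i y0 \<bullet> w0) *\<^sub>R a i y0)"
        unfolding a_def by (simp only: linear_sum[OF lin[OF y0]] linear_scale[OF lin[OF y0]])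
      then show ?thesis by (simp add: b_def scaleR_sum_right)
    qed
    \<comment> \<open>\<open>\<delta>\<close> is what the linearised step gains on the unit vector \<open>w0\<close>; the error of linearisation,
      \<open>\<eta> * norm u0\<close> in the limit, is chosen below it.\<close>
    define \<delta> where "\<delta> = 1 - norm (?D (0, u0) - w0)"
    have "\<delta> > 0"
      using \<open>norm (w0 - _) < norm w0\<close> w0 unfolding \<delta>_def Du0 by (simp add: norm_minus_commute)
    define \<eta> where "\<eta> = \<delta> / (norm u0 + 1)"
    have "\<eta> > 0" using \<open>\<delta> > 0\<close> by (simp add: \<eta>_def add_nonneg_pos)
    obtain \<rho> where \<rho>: "0 < \<rho>" "\<And>x y. x \<in> ball (y0, t y0) \<rho> \<Longrightarrow> y \<in> ball (y0, t y0) \<rho> \<Longrightarrow>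
        norm (Sx y - Sx x - ?D (y - x)) \<le> \<eta> * norm (y - x)"
      using C1_strictly_differentiable[OF Sx(1) p\<Omega>[OF y0] D \<open>\<eta> > 0\<close>] by metis
    have "eventually (\<lambda>n. (y' n, t (y' n)) \<in> ball (y0, t y0) \<rho>) sequentially"
      using lim_p \<rho>(1) by (auto simp: tendsto_iff dist_commute)
    moreover have "eventually (\<lambda>n. (y' n, t (y' n) + \<nu> n *\<^sub>R u n) \<in> ball (y0, t y0) \<rho>) sequentially"
      using lim_q \<rho>(1) by (auto simp: tendsto_iff dist_commute)
    ultimately have ev: "eventually (\<lambda>n. 1 - 1 / (real (r n) + 1) \<le> \<eta> * norm (u n) + norm (?D (0, u n) - w' n)) sequentially"
    proof eventually_elim
      case (elim n)
      let ?q = "(y' n, t (y' n) + \<nu> n *\<^sub>R u n)"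
      have qS: "Sx ?q = S ?q" using tvF[OF yC, of n "z' n - y' n"] Sx(4) unfolding v_scale by blast
      have pS: "Sx (y' n, t (y' n)) = y' n" using Sx(4) t(2,3) yC by simp
      have diff: "?q - (y' n, t (y' n)) = \<nu> n *\<^sub>R (0, u n)" by simp
      have st: "norm (S ?q - y' n - \<nu> n *\<^sub>R ?D (0, u n)) \<le> \<eta> * (\<nu> n * norm (u n))"
        using \<rho>(2)[OF elim] \<nu>_pos[of n] unfolding diff qS pS
        by (simp add: linear_scale[OF lin[OF y0]] norm_Pair del: scaleR_Pair)
      have eq: "S ?q - z' n = (S ?q - y' n - \<nu> n *\<^sub>R ?D (0, u n)) + \<nu> n *\<^sub>R (?D (0, u n) - w' n)"
        using zy[of n] by (simp add: algebra_simps)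
      have "norm (S ?q - z' n) \<le> norm (S ?q - y' n - \<nu> n *\<^sub>R ?D (0, u n)) + norm (\<nu> n *\<^sub>R (?D (0, u n) - w' n))"
        unfolding eq by (rule norm_triangle_ineq)
      then have "norm (S ?q - z' n) \<le> \<eta> * (\<nu> n * norm (u n)) + \<nu> n * norm (?D (0, u n) - w' n)"
        using st \<nu>_pos[of n] by simp
      moreover have "(1 - 1 / (real (r n) + 1)) * \<nu> n < norm (S ?q - z' n)"
        using far[of "r n"] v_scale[of n] unfolding y'_def z'_def \<nu>_def by simp
      ultimately have "(1 - 1 / (real (r n) + 1)) * \<nu> n < (\<eta> * norm (u n) + norm (?D (0, u n) - w' n)) * \<nu> n"
        by (simp add: algebra_simps)
      then show ?case using \<nu>_pos[of n] by (simp add: mult_less_cancel_right)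
    qed
    have "1 - 0 \<le> \<eta> * norm u0 + norm (?D (0, u0) - w0)"
    proof (rule tendsto_le[OF sequentially_bot _ _ ev])
      show "(\<lambda>n. 1 - 1 / (real (r n) + 1)) \<longlonglongrightarrow> 1 - 0" by (intro tendsto_intros lim1)
      have "(\<lambda>n. ?D (0, u n)) \<longlonglongrightarrow> ?D (0, u0)"
        by (intro bounded_linear.tendsto[OF has_derivative_bounded_linear[OF D(1)[OF p\<Omega>[OF y0]]]]
            tendsto_intros lim_u)
      then show "(\<lambda>n. \<eta> * norm (u n) + norm (?D (0, u n) - w' n)) \<longlonglongrightarrow> \<eta> * norm u0 + norm (?D (0, u0) - w0)"
        by (intro tendsto_intros lim_u lim_w)
    qed
    then have "\<delta> \<le> \<eta> * norm u0" by (simp add: \<delta>_def)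
    also have "\<dots> < \<delta>"
      using \<open>\<delta> > 0\<close> by (simp add: \<eta>_def pos_divide_less_eq add_nonneg_pos)
    finally show False by simp
  qed
  then obtain n where n: "\<forall>y\<in>C. \<forall>z\<in>Y. norm (z - y) \<le> 1 / (real n + 1) \<longrightarrow> contracts n y z"
    by blast
  show ?thesis
    by (rule that[of "1 / (real n + 1)" "1 - 1 / (real n + 1)" b])
      (use n b_cont in \<open>auto simp: contracts_def\<close>)
qed


section \<open>Improving approximations by regular maps\<close>

lemma algebraic_set_closed:
  assumes "algebraic_set X"
  shows "closed X"
proof -
  obtain \<P> where \<P>: "\<forall>P\<in>\<P>. real_polynomial_function P" "X = {x. \<forall>P\<in>\<P>. P x = 0}"
    using assms unfolding algebraic_set_def by blast
  have "closed {x. P x = 0}" if "P \<in> \<P>" for P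
  proof -
    have "continuous_on UNIV P"
      using \<P>(1) that real_polynomial_function_eq
      by (intro continuous_on_polymonial_function) blast
    then show ?thesis by (intro closed_Collect_eq) auto
  qed
  then have "closed (\<Inter>P\<in>\<P>. {x. P x = 0})" by (intro closed_INT) blast
  moreover have "X = (\<Inter>P\<in>\<P>. {x. P x = 0})" using \<P>(2) by auto
  ultimately show ?thesis by simp
qed

text \<open>
By Stone-Weierstrass the coefficients can be replaced by polynomials. The sections \<open>\<sigma> i\<close> take
  values in the fibres everywhere on \<open>Y\<close>, so the resulting section lies in \<open>F\<close> over all of \<open>X\<close>
  and not just over \<open>K\<close>.
\<close>

lemma regular_sections_dense:
  fixes g :: "'a::euclidean_space \<Rightarrow> 'b::euclidean_space" and \<sigma> :: "'i \<Rightarrow> 'b \<Rightarrow> 'f::euclidean_space"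
  assumes g: "regular_map X Y g" and K: "compact K" "K \<subseteq> X"
    and fibre: "\<And>y. y \<in> Y \<Longrightarrow> subspace {v. (y, v) \<in> F}"
    and I: "finite I" and \<sigma>: "\<And>i. i \<in> I \<Longrightarrow> polynomial_function (\<sigma> i)"
      "\<And>i y. i \<in> I \<Longrightarrow> y \<in> Y \<Longrightarrow> (y, \<sigma> i y) \<in> F"
    and c: "\<And>i. i \<in> I \<Longrightarrow> continuous_on K (c i)" and "0 < \<delta>"
  obtains v where "regular_map X F (\<lambda>x. (g x, v x))"
    "\<And>x. x \<in> K \<Longrightarrow> norm (v x - (\<Sum>i\<in>I. c i x *\<^sub>R \<sigma> i (g x))) \<le> \<delta>"
proof -
  have gY: "g x \<in> Y" if "x \<in> X" for x using g that unfolding regular_map_def by blast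
  have g': "regular_map X UNIV g" using g regular_map_UNIV by blast
  have \<sigma>g: "regular_map X UNIV (\<lambda>x. \<sigma> i (g x))" if "i \<in> I" for i
    using regular_map_compose[OF regular_map_polynomial[OF \<sigma>(1)[OF that], of UNIV UNIV] g'] by simp
  have "bounded ((\<lambda>x. \<Sum>i\<in>I. norm (\<sigma> i (g x))) ` K)"
    using K(2) by (intro compact_imp_bounded compact_continuous_image continuous_intros K(1)
        continuous_on_subset[OF regular_map_continuous_on[OF \<sigma>g]])
  then obtain B where B: "B > 0" "\<And>x. x \<in> K \<Longrightarrow> (\<Sum>i\<in>I. norm (\<sigma> i (g x))) \<le> B"
    unfolding bounded_pos by fastforce
  have "0 < \<delta> / B" using \<open>0 < \<delta>\<close> B(1) by simp
  then have "\<exists>p. real_polynomial_function p \<and> (\<forall>x\<in>K. \<bar>c i x - p x\<bar> < \<delta> / B)" if "i \<in> I" for i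
    by (rule Stone_Weierstrass_real_polynomial_function[OF K(1) c[OF that]]) blast
  then obtain p where p: "\<And>i. i \<in> I \<Longrightarrow> real_polynomial_function (p i)"
      "\<And>i x. i \<in> I \<Longrightarrow> x \<in> K \<Longrightarrow> \<bar>c i x - p i x\<bar> < \<delta> / B"
    by metis
  define v where "v x = (\<Sum>i\<in>I. p i x *\<^sub>R \<sigma> i (g x))" for x
  have "regular_map X UNIV v"
    unfolding v_def by (intro regular_map_sum regular_map_scaleR regular_function_polynomial p(1) \<sigma>g)
  then have "regular_map X UNIV (\<lambda>x. (g x, v x))"
    using regular_map_Pair[OF g'] by fastforce
  moreover have "(g x, v x) \<in> F" if "x \<in> X" for x
    using subspace_sum[OF fibre[OF gY[OF that]], of I "\<lambda>i. p i x *\<^sub>R \<sigma> i (g x)"]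
      subspace_mul[OF fibre[OF gY[OF that]]] \<sigma>(2) gY[OF that] unfolding v_def by simp
  ultimately have "regular_map X F (\<lambda>x. (g x, v x))"
    using regular_map_UNIV[of X F] by blast
  moreover have "norm (v x - (\<Sum>i\<in>I. c i x *\<^sub>R \<sigma> i (g x))) \<le> \<delta>" if x: "x \<in> K" for x
  proof -
    have "norm (v x - (\<Sum>i\<in>I. c i x *\<^sub>R \<sigma> i (g x))) = norm (\<Sum>i\<in>I. (p i x - c i x) *\<^sub>R \<sigma> i (g x))"
      unfolding v_def by (simp add: sum_subtractf scaleR_diff_left)
    also have "\<dots> \<le> (\<Sum>i\<in>I. \<delta> / B * norm (\<sigma> i (g x)))"
    proof (rule sum_norm_le)
      fix i assume "i \<in> I"
      then have "\<bar>p i x - c i x\<bar> \<le> \<delta> / B" using p(2)[OF _ x] by (simp add: abs_minus_commute less_imp_le)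
      then show "norm ((p i x - c i x) *\<^sub>R \<sigma> i (g x)) \<le> \<delta> / B * norm (\<sigma> i (g x))"
        unfolding norm_scaleR by (intro mult_right_mono) auto
    qed
    also have "\<dots> = \<delta> / B * (\<Sum>i\<in>I. norm (\<sigma> i (g x)))" by (simp add: sum_distrib_left)
    also have "\<dots> \<le> \<delta> / B * B"
      using B \<open>0 < \<delta>\<close> x by (intro mult_left_mono) auto
    finally show ?thesis using B(1) by simp
  qed
  ultimately show ?thesis using that by blast
qed

text \<open>
One gradient step, followed by approximation of the section over \<open>K\<close> by a regular one, takes
  a regular map \<open>g\<close> to a regular map whose distance to \<open>f\<close> on \<open>K\<close> is smaller by a fixed factor;
  iteration makes the distance arbitrarily small. The decisive point is the order of
  quantifiers: \<open>\<epsilon>\<close> depends on the bounded region that contains the values of \<open>f\<close> but not on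
  \<open>f\<close> or \<open>g\<close>, so the same \<open>\<epsilon>\<close> serves along a whole homotopy.
\<close>

lemma quasi_malleable_self_improving_approximation:
  fixes Y :: "'b::euclidean_space set" and R :: real
  assumes Y: "algebraic_set Y" and qm: "quasi_malleable TYPE('e::euclidean_space) TYPE('f::euclidean_space) Y"
  obtains \<epsilon> where "0 < \<epsilon>"
    "\<And>(X :: 'a::euclidean_space set) K f g \<delta>. compact K \<Longrightarrow> K \<subseteq> X \<Longrightarrow> continuous_on K f \<Longrightarrow>
       f ` K \<subseteq> Y \<inter> cball 0 R \<Longrightarrow> regular_map X Y g \<Longrightarrow> (\<And>x. x \<in> K \<Longrightarrow> dist (f x) (g x) \<le> \<epsilon>) \<Longrightarrow>
       0 < \<delta> \<Longrightarrow> \<exists>h. regular_map X Y h \<and> (\<forall>x\<in>K. dist (f x) (h x) \<le> \<delta>)"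
proof -
  obtain E :: "('b, 'e) vbundle" and s \<tau> where E: "quasi_spray TYPE('f) Y E s \<tau>" "dominating Y E s \<tau>"
    using qm unfolding quasi_malleable_def by blast
  \<comment> \<open>\<open>f\<close> takes values in the ball of radius \<open>R\<close>, and maps at distance at most \<open>1\<close> from it have
    values in \<open>C\<close>; the spray data are used over the larger set \<open>V\<close>, which is open in \<open>Y\<close>.\<close>
  define V where "V = Y \<inter> ball 0 (R + 2)"
  define C where "C = Y \<inter> cball 0 (R + 1)"
  have clY: "closed Y" by (rule algebraic_set_closed[OF Y])
  have "closure V \<subseteq> cball 0 (R + 2)"
    unfolding V_def by (rule closure_minimal) auto
  then have "bounded (Y \<inter> closure V)"
    using bounded_cball bounded_subset by blast
  then have V: "V \<in> relatively_compact_open Y"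
    unfolding relatively_compact_open_def using clY
    by (simp add: compact_eq_bounded_closed closed_Int V_def openin_open_Int)
  have C: "compact C" "C \<subseteq> Y" "C \<subseteq> V"
    unfolding C_def V_def using clY by (auto simp: closed_Int_compact)
  obtain F :: "('b \<times> 'f) set" and S t where F: "algebraic_subbundle Y F" and S: "regular_map F Y S"
    and t: "continuous_on V t" "\<And>y. y \<in> V \<Longrightarrow> (y, t y) \<in> F" "\<And>y. y \<in> V \<Longrightarrow> S (y, t y) = y"
    and dom: "\<And>y w. y \<in> V \<Longrightarrow> w \<in> tangent_space Y y \<Longrightarrow>
       \<exists>l. (y, l) \<in> F \<and> ((\<lambda>r. S (y, t y + r *\<^sub>R l)) has_vector_derivative w) (at 0)"
    by (rule quasi_spray_on_subbundle[OF E V]) (rule that)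
  have fibre: "\<And>y. y \<in> Y \<Longrightarrow> subspace {v. (y, v) \<in> F}" and F_alg: "algebraic_set F"
    using F unfolding algebraic_subbundle_def by auto
  obtain I :: "('b \<times> 'f) set" and \<sigma> :: "'b \<times> 'f \<Rightarrow> 'b \<Rightarrow> 'f" and \<gamma> :: "'b \<times> 'f \<Rightarrow> 'b \<times> 'f \<Rightarrow> real"
    where I: "finite I" and \<sigma>: "\<And>i. i \<in> I \<Longrightarrow> polynomial_function (\<sigma> i)"
    "\<And>i y. i \<in> I \<Longrightarrow> y \<in> Y \<Longrightarrow> (y, \<sigma> i y) \<in> F"
    and \<gamma>: "\<And>i. i \<in> I \<Longrightarrow> continuous_on (F \<inter> (C \<times> UNIV)) (\<gamma> i)"
    "\<And>y v. (y, v) \<in> F \<Longrightarrow> y \<in> C \<Longrightarrow> v = (\<Sum>i\<in>I. \<gamma> i (y, v) *\<^sub>R \<sigma> i y)"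
    by (rule algebraic_subbundle_compact_sections[OF F C(1,2)]) (rule that)
  have tC: "continuous_on C t" using t(1) C(3) continuous_on_subset by blast
  have \<sigma>C: "continuous_on C (\<sigma> i)" if "i \<in> I" for i
    by (rule continuous_on_polymonial_function[OF \<sigma>(1)[OF that]])
  have span: "v \<in> span ((\<lambda>i. \<sigma> i y) ` I)" if "y \<in> C" "(y, v) \<in> F" for y v
  proof -
    have "(\<Sum>i\<in>I. \<gamma> i (y, v) *\<^sub>R \<sigma> i y) \<in> span ((\<lambda>i. \<sigma> i y) ` I)"
      by (intro span_sum span_mul span_base) auto
    then show ?thesis using \<gamma>(2)[OF that(2,1)] by simp
  qed
  obtain b :: "'b \<times> 'f \<Rightarrow> 'b \<Rightarrow> 'b" and \<epsilon>' \<kappa> where \<epsilon>': "0 < \<epsilon>'" and \<kappa>: "0 \<le> \<kappa>" "\<kappa> < 1"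
    and b: "\<And>i. i \<in> I \<Longrightarrow> continuous_on C (b i)"
    and step: "\<And>y z. y \<in> C \<Longrightarrow> z \<in> Y \<Longrightarrow> norm (z - y) \<le> \<epsilon>' \<Longrightarrow>
       norm (S (y, t y + (\<Sum>i\<in>I. (b i y \<bullet> (z - y)) *\<^sub>R \<sigma> i y)) - z) \<le> \<kappa> * norm (z - y)"
  proof (rule spray_gradient_step[OF C(1,2) S tC _ _ _ I \<sigma>C])
    show "\<And>y w. y \<in> C \<Longrightarrow> w \<in> tangent_space Y y \<Longrightarrow>
       \<exists>l. (y, l) \<in> F \<and> ((\<lambda>r. S (y, t y + r *\<^sub>R l)) has_vector_derivative w) (at 0)"
      using dom C(3) by blast
  qed (use t C fibre \<sigma>(2) span in \<open>auto simp: subset_iff\<close>)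
  define \<epsilon> where "\<epsilon> = min \<epsilon>' 1"
  have \<epsilon>: "0 < \<epsilon>" "\<epsilon> \<le> \<epsilon>'" "\<epsilon> \<le> 1" using \<epsilon>' by (auto simp: \<epsilon>_def)
  have improve: "\<exists>h. regular_map X Y h \<and> (\<forall>x\<in>K. dist (f x) (h x) \<le> e')"
    if K: "compact K" "K \<subseteq> X" and f: "continuous_on K f" "f ` K \<subseteq> Y \<inter> cball 0 R"
      and g: "regular_map X Y g" "\<forall>x\<in>K. dist (f x) (g x) \<le> e" and e: "e \<le> \<epsilon>" "\<kappa> * e < e'"
    for X :: "'a set" and K f g e e'
  proof -
    have fY: "f x \<in> Y" if "x \<in> K" for x using f(2) that by blast
    have gC: "g x \<in> C" if x: "x \<in> K" for x
    proof -
      have "norm (g x) \<le> norm (f x) + dist (f x) (g x)" by norm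
      also have "\<dots> \<le> R + 1" using f(2) g(2) e(1) \<epsilon>(3) x by (intro add_mono) auto
      finally show ?thesis using g(1) x K(2) unfolding C_def regular_map_def by auto
    qed
    have gK: "continuous_on K g"
      by (rule continuous_on_subset[OF regular_map_continuous_on[OF g(1)] K(2)])
    \<comment> \<open>The coordinates of \<open>t (g x)\<close>, corrected by the gradient step from \<open>g x\<close> towards \<open>f x\<close>.\<close>
    define c where "c i x = \<gamma> i (g x, t (g x)) + b i (g x) \<bullet> (f x - g x)" for i x
    have on_C: "continuous_on K (\<lambda>x. h (g x))" if "continuous_on C h" for h :: "'b \<Rightarrow> 'x::topological_space"
      by (rule continuous_on_compose2[OF that gK]) (use gC in blast)
    have c_cont: "continuous_on K (c i)" if i: "i \<in> I" for i
    proof -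
      have "continuous_on K (\<lambda>x. \<gamma> i (g x, t (g x)))"
        by (rule continuous_on_compose2[OF \<gamma>(1)[OF i]])
          (use gC t(2) C(3) in \<open>auto intro!: continuous_on_Pair gK on_C tC\<close>)
      then show ?thesis
        unfolding c_def by (intro continuous_on_add continuous_on_inner continuous_on_diff f(1) gK on_C[OF b[OF i]])
    qed
    let ?v = "\<lambda>x. \<Sum>i\<in>I. c i x *\<^sub>R \<sigma> i (g x)"
    have v_eq: "?v x = t (g x) + (\<Sum>i\<in>I. (b i (g x) \<bullet> (f x - g x)) *\<^sub>R \<sigma> i (g x))" if x: "x \<in> K" for x
    proof -
      have "t (g x) = (\<Sum>i\<in>I. \<gamma> i (g x, t (g x)) *\<^sub>R \<sigma> i (g x))"
        using \<gamma>(2)[OF t(2) gC[OF x]] gC[OF x] C(3) by blast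
      then show ?thesis by (simp add: c_def scaleR_add_left sum.distrib)
    qed
    have v_step: "norm (S (g x, ?v x) - f x) \<le> \<kappa> * e" if x: "x \<in> K" for x
    proof -
      have n: "norm (f x - g x) \<le> e" using g(2) x by (simp add: dist_norm)
      then have "norm (S (g x, ?v x) - f x) \<le> \<kappa> * norm (f x - g x)"
        unfolding v_eq[OF x] using e(1) \<epsilon>(2) by (intro step gC fY x) auto
      also have "\<dots> \<le> \<kappa> * e" using n \<kappa>(1) by (rule mult_left_mono)
      finally show ?thesis .
    qed
    have vF: "(g x, ?v x) \<in> F" if x: "x \<in> K" for x
    proof -
      have "g x \<in> Y" using gC[OF x] C(2) by blast
      then show ?thesis
        using subspace_sum[OF fibre, of "g x" I "\<lambda>i. c i x *\<^sub>R \<sigma> i (g x)"]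
          subspace_mul[OF fibre, of "g x"] \<sigma>(2) by simp
    qed
    have "bounded (?v ` K)"
      by (intro compact_imp_bounded compact_continuous_image continuous_intros c_cont on_C \<sigma>C K)
    then obtain B where B: "\<And>x. x \<in> K \<Longrightarrow> norm (?v x) \<le> B"
      unfolding bounded_iff by blast
    let ?Q = "F \<inter> (C \<times> cball 0 (B + 1))"
    have "compact ?Q"
      by (intro closed_Int_compact algebraic_set_closed F_alg compact_Times C compact_cball)
    then have "uniformly_continuous_on ?Q S"
      by (intro compact_uniformly_continuous continuous_on_subset[OF regular_map_continuous_on[OF S]]) auto
    moreover have "0 < e' - \<kappa> * e" using e(2) by simp
    ultimately obtain d where d: "d > 0" "\<And>p q. p \<in> ?Q \<Longrightarrow> q \<in> ?Q \<Longrightarrow> dist q p < d \<Longrightarrow> dist (S q) (S p) < e' - \<kappa> * e"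
      unfolding uniformly_continuous_on_def by metis
    define \<delta> where "\<delta> = min 1 (d / 2)"
    have \<delta>: "0 < \<delta>" "\<delta> \<le> 1" "\<delta> < d" using d(1) by (auto simp: \<delta>_def)
    obtain v where v: "regular_map X F (\<lambda>x. (g x, v x))" "\<And>x. x \<in> K \<Longrightarrow> norm (v x - ?v x) \<le> \<delta>"
    proof (rule regular_sections_dense[where c = c and F = F and \<sigma> = \<sigma>, OF g(1) K _ I _ _ _ \<delta>(1)])
    qed (use that fibre \<sigma> c_cont in auto)
    have "dist (f x) (S (g x, v x)) \<le> e'" if x: "x \<in> K" for x
    proof -
      have "(g x, v x) \<in> F" using v(1) x K(2) unfolding regular_map_def by blast
      moreover have "norm (v x) \<le> norm (?v x) + norm (v x - ?v x)" by norm
      then have "norm (v x) \<le> B + 1" using B[OF x] v(2)[OF x] \<delta>(2) by linarith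
      ultimately have vQ: "(g x, v x) \<in> ?Q" using gC[OF x] by simp
      have "(g x, ?v x) \<in> ?Q" using vF[OF x] gC[OF x] B[OF x] by simp
      moreover have "dist (g x, v x) (g x, ?v x) < d"
        using v(2)[OF x] \<delta>(3) by (simp add: dist_Pair_Pair dist_norm)
      ultimately have "dist (S (g x, v x)) (S (g x, ?v x)) < e' - \<kappa> * e"
        using vQ by (intro d(2))
      moreover have "dist (S (g x, ?v x)) (f x) \<le> \<kappa> * e" using v_step[OF x] by (simp add: dist_norm)
      ultimately have "dist (S (g x, v x)) (f x) \<le> e'"
        using dist_triangle[of "S (g x, v x)" "f x" "S (g x, ?v x)"] by linarith
      then show ?thesis by (simp add: dist_commute)
    qed
    moreover have "regular_map X Y (\<lambda>x. S (g x, v x))" by (rule regular_map_compose[OF S v(1)])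
    ultimately show ?thesis by blast
  qed
  \<comment> \<open>A factor strictly between \<open>\<kappa>\<close> and \<open>1\<close> leaves room for the error of approximation.\<close>
  define \<mu> where "\<mu> = (1 + \<kappa>) / 2"
  have \<mu>: "\<kappa> < \<mu>" "0 < \<mu>" "\<mu> < 1" using \<kappa> by (auto simp: \<mu>_def)
  show ?thesis
  proof (rule that[OF \<epsilon>(1)])
    fix X :: "'a set" and K f g \<delta>
    assume K: "compact K" "K \<subseteq> X" and f: "continuous_on K f" "f ` K \<subseteq> Y \<inter> cball 0 R"
      and g: "regular_map X Y g" "\<And>x. x \<in> K \<Longrightarrow> dist (f x) (g x) \<le> \<epsilon>" and "0 < (\<delta>::real)"
    have "\<exists>h. regular_map X Y h \<and> (\<forall>x\<in>K. dist (f x) (h x) \<le> \<epsilon> * \<mu> ^ n)" for n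
    proof (induction n)
      case 0
      then show ?case using g by auto
    next
      case (Suc n)
      then obtain h where h: "regular_map X Y h" "\<forall>x\<in>K. dist (f x) (h x) \<le> \<epsilon> * \<mu> ^ n" by blast
      have "\<epsilon> * \<mu> ^ n \<le> \<epsilon>"
        using \<mu> \<epsilon>(1) by (simp add: mult_left_le power_le_one)
      moreover have "\<kappa> * (\<epsilon> * \<mu> ^ n) < \<epsilon> * \<mu> ^ Suc n"
        using \<mu>(1,2) \<epsilon>(1) by simp
      ultimately show ?case by (rule improve[OF K f h])
    qed
    moreover obtain n where "\<mu> ^ n < \<delta> / \<epsilon>"
      using real_arch_pow_inv[of "\<delta> / \<epsilon>" \<mu>] \<mu>(3) \<open>0 < \<delta>\<close> \<epsilon>(1) by auto
    ultimately obtain h where h: "regular_map X Y h" "\<forall>x\<in>K. dist (f x) (h x) \<le> \<epsilon> * \<mu> ^ n" by blast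
    have "\<epsilon> * \<mu> ^ n \<le> \<delta>"
      using \<open>\<mu> ^ n < \<delta> / \<epsilon>\<close> \<epsilon>(1) by (simp add: pos_less_divide_eq mult.commute)
    then show "\<exists>h. regular_map X Y h \<and> (\<forall>x\<in>K. dist (f x) (h x) \<le> \<delta>)"
      using h by (meson order_trans)
  qed
qed


section \<open>Approximation along homotopies\<close>

text \<open>
The homotopy is cut into steps that move points by less than half of the threshold \<open>\<epsilon>\<close> of
  \<open>quasi_malleable_self_improving_approximation\<close>. A regular map within \<open>\<epsilon> / 2\<close> of one stage is
  then within \<open>\<epsilon>\<close> of the next one, and can be improved there to any precision, in particular
  to \<open>\<epsilon> / 2\<close> again.
\<close>

lemma homotopic_to_regular_imp_approximable:
  fixes Y :: "'b::euclidean_space set" and X K :: "'a::euclidean_space set"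
  assumes Y: "algebraic_set Y" "quasi_malleable TYPE('e::euclidean_space) TYPE('f::euclidean_space) Y"
    and K: "compact K" "K \<subseteq> X"
    and H: "continuous_on ({0..1::real} \<times> K) H" "H ` ({0..1} \<times> K) \<subseteq> Y"
    and g: "regular_map X Y g" "\<And>x. x \<in> K \<Longrightarrow> H (0, x) = g x" and \<delta>: "0 < \<delta>"
  shows "\<exists>h. regular_map X Y h \<and> (\<forall>x\<in>K. dist (H (1, x)) (h x) \<le> \<delta>)"
proof -
  have cK: "compact ({0..1::real} \<times> K)" by (intro compact_Times K compact_Icc)
  then have "bounded (H ` ({0..1} \<times> K))"
    by (intro compact_imp_bounded compact_continuous_image H(1))
  then obtain R where R: "\<forall>z\<in>H ` ({0..1} \<times> K). norm z \<le> R"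
    unfolding bounded_iff by (elim exE)
  have HR: "(\<lambda>x. H (s, x)) ` K \<subseteq> Y \<inter> cball 0 R" if "s \<in> {0..1}" for s
  proof (rule image_subsetI)
    fix x assume "x \<in> K"
    then have "H (s, x) \<in> H ` ({0..1} \<times> K)" using that by blast
    then show "H (s, x) \<in> Y \<inter> cball 0 R" using H(2) R by auto
  qed
  have Hs: "continuous_on K (\<lambda>x. H (s, x))" if "s \<in> {0..1}" for s
    by (rule continuous_on_compose2[OF H(1)]) (use that in \<open>auto intro!: continuous_intros\<close>)
  show ?thesis
  proof (rule quasi_malleable_self_improving_approximation[OF Y, where R = R and ?'a = 'a])
    fix \<epsilon> :: real
    assume \<epsilon>: "0 < \<epsilon>" and improve:
      "\<And>(X :: 'a::euclidean_space set) K f g \<delta>. compact K \<Longrightarrow> K \<subseteq> X \<Longrightarrow> continuous_on K f \<Longrightarrow>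
       f ` K \<subseteq> Y \<inter> cball 0 R \<Longrightarrow> regular_map X Y g \<Longrightarrow> (\<And>x. x \<in> K \<Longrightarrow> dist (f x) (g x) \<le> \<epsilon>) \<Longrightarrow>
       0 < \<delta> \<Longrightarrow> \<exists>h. regular_map X Y h \<and> (\<forall>x\<in>K. dist (f x) (h x) \<le> \<delta>)"
    have "uniformly_continuous_on ({0..1} \<times> K) H"
      by (rule compact_uniformly_continuous[OF H(1) cK])
    then obtain d where d: "d > 0" "\<And>p q. p \<in> {0..1} \<times> K \<Longrightarrow> q \<in> {0..1} \<times> K \<Longrightarrow> dist q p < d \<Longrightarrow> dist (H q) (H p) < \<epsilon> / 2"
      using \<epsilon> unfolding uniformly_continuous_on_def by (metis half_gt_zero)
    obtain N where N: "N \<noteq> 0" "1 / real N < d"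
      using real_arch_inverse[of d] d(1) by (auto simp: inverse_eq_divide)
    have "\<forall>\<delta>>0. \<exists>h. regular_map X Y h \<and> (\<forall>x\<in>K. dist (H (real n / real N, x)) (h x) \<le> \<delta>)" if "n \<le> N" for n
      using that
    proof (induction n)
      case 0
      then show ?case using g by (intro allI impI exI[of _ g]) auto
    next
      case (Suc n)
      let ?s = "real n / real N" and ?s' = "real (Suc n) / real N"
      have ss: "?s \<in> {0..1}" "?s' \<in> {0..1}" using Suc.prems N(1) by (auto simp: divide_simps)
      obtain h where h: "regular_map X Y h" "\<forall>x\<in>K. dist (H (?s, x)) (h x) \<le> \<epsilon> / 2"
        using Suc \<epsilon> by (meson Suc_leD half_gt_zero)
      have "dist (H (?s', x)) (h x) \<le> \<epsilon>" if x: "x \<in> K" for x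
      proof -
        have "?s' - ?s = 1 / real N" by (simp add: diff_divide_distrib[symmetric])
        then have "dist (?s', x) (?s, x) < d" using N(2) by (simp add: dist_Pair_Pair dist_real_def)
        then have "dist (H (?s', x)) (H (?s, x)) < \<epsilon> / 2" using ss x by (intro d(2)) auto
        then show ?thesis
          using h(2) x dist_triangle[of "H (?s', x)" "h x" "H (?s, x)"] by force
      qed
      then show ?case
        using improve[OF K Hs[OF ss(2)] HR[OF ss(2)] h(1)] by blast
    qed
    from this[of N] show ?thesis using N(1) \<delta> by simp
  qed
qed

text \<open>
A finite intersection of subbasic sets involves finitely many compact sets, and an open
  neighbourhood of the compact set \<open>f ` K\<close> contains a uniform one.
\<close>

lemma compact_open_topology_uniform_neighbourhood:
  fixes D :: "'a::topological_space set" and Y :: "'b::heine_borel set"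
  assumes "openin (compact_open_topology D Y) \<U>" "f \<in> \<U>"
  obtains K \<delta> where "compact K" "K \<subseteq> D" "0 < \<delta>"
    "\<And>h. h \<in> continuous_maps D Y \<Longrightarrow> \<forall>x\<in>K. dist (f x) (h x) \<le> \<delta> \<Longrightarrow> h \<in> \<U>"
proof -
  define nbhd where "nbhd U f K \<delta> \<longleftrightarrow> compact K \<and> K \<subseteq> D \<and> 0 < \<delta> \<and>
      (\<forall>h\<in>continuous_maps D Y. (\<forall>x\<in>K. dist (f x) (h x) \<le> \<delta>) \<longrightarrow> h \<in> U)" for U f K and \<delta> :: real
  have "\<forall>f\<in>\<U>. f \<in> continuous_maps D Y \<longrightarrow> (\<exists>K \<delta>. nbhd \<U> f K \<delta>)"
    using assms(1)[unfolded compact_open_topology_def openin_topology_generated_by_iff]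
  proof (induction \<U> rule: generate_topology_on.induct)
    case Empty
    then show ?case by simp
  next
    case (Int U V)
    show ?case
    proof (intro ballI impI)
      fix f assume f: "f \<in> U \<inter> V" "f \<in> continuous_maps D Y"
      obtain K \<delta> where 1: "nbhd U f K \<delta>" using Int f by blast
      obtain L \<eta> where 2: "nbhd V f L \<eta>" using Int f by blast
      have "nbhd (U \<inter> V) f (K \<union> L) (min \<delta> \<eta>)"
        using 1 2 unfolding nbhd_def by (auto intro: compact_Un)
      then show "\<exists>K \<delta>. nbhd (U \<inter> V) f K \<delta>" by blast
    qed
  next
    case (UN \<K>)
    show ?case
    proof (intro ballI impI)
      fix f assume f: "f \<in> \<Union>\<K>" "f \<in> continuous_maps D Y"
      then obtain U K \<delta> where "U \<in> \<K>" "nbhd U f K \<delta>" using UN by blast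
      then have "nbhd (\<Union>\<K>) f K \<delta>" unfolding nbhd_def by blast
      then show "\<exists>K \<delta>. nbhd (\<Union>\<K>) f K \<delta>" by blast
    qed
  next
    case (Basis U)
    then obtain K W where U: "U = {f \<in> continuous_maps D Y. f ` K \<subseteq> W}"
      and K: "compact K" "K \<subseteq> D" and "openin (top_of_set Y) W" by blast
    then obtain W' where W': "open W'" "W = Y \<inter> W'" by (meson openin_open)
    show ?case
    proof (intro ballI impI)
      fix f assume f: "f \<in> U" "f \<in> continuous_maps D Y"
      have "compact (f ` K)"
        using f(2) K unfolding continuous_maps_def
        by (auto intro: compact_continuous_image continuous_on_subset)
      moreover have "f ` K \<subseteq> W'" using f(1) U W'(2) by blast
      ultimately obtain \<delta> where \<delta>: "0 < \<delta>" "(\<Union>y\<in>f ` K. cball y \<delta>) \<subseteq> W'"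
        using compact_subset_open_imp_cball_epsilon_subset[OF _ W'(1)] by metis
      have "nbhd U f K \<delta>"
        unfolding nbhd_def
      proof (intro conjI ballI impI K \<delta>(1))
        fix h assume h: "h \<in> continuous_maps D Y" "\<forall>x\<in>K. dist (f x) (h x) \<le> \<delta>"
        have "h ` K \<subseteq> W"
        proof (rule image_subsetI)
          fix x assume x: "x \<in> K"
          then have "h x \<in> cball (f x) \<delta>" using h(2) by simp
          moreover have "h x \<in> Y" using h(1) x K(2) unfolding continuous_maps_def by blast
          moreover have "cball (f x) \<delta> \<subseteq> W'" using \<delta>(2) x by blast
          ultimately show "h x \<in> W" using W'(2) by blast
        qed
        then show "h \<in> U" using U h(1) by blast
      qed
      then show "\<exists>K \<delta>. nbhd U f K \<delta>" by blast
    qed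
  qed
  moreover have "f \<in> continuous_maps D Y"
    using openin_subset[OF assms(1)] assms(2) topspace_compact_open_topology by blast
  ultimately obtain K \<delta> where "nbhd \<U> f K \<delta>" using assms(2) by blast
  then show ?thesis by (intro that[of K \<delta>]) (auto simp: nbhd_def)
qed

text \<open>
  Composing \<open>f\<close> with a contraction of \<open>D\<close> gives a homotopy from a constant map, which is
  regular on all of \<open>X\<close>, to \<open>f\<close>. The contraction may move points out of the compact set \<open>K\<close>,
  but only the restriction of \<open>f \<circ> G\<close> to \<open>{0..1} \<times> K\<close> matters.
\<close>

theorem corollary1p13:
  fixes Y :: "'b::euclidean_space set" and X D :: "'a::euclidean_space set"
  assumes "algebraic_set Y" and "nonsingular Y"
    and "quasi_malleable TYPE('e::euclidean_space) TYPE('f::euclidean_space) Y"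
    and "algebraic_set X"
    and "D \<subseteq> X" and "contractible D" and "D \<noteq> {}"
  shows "\<forall>f\<in>continuous_maps D Y. approximable_by_regular_maps X D Y f"
proof
  fix f assume "f \<in> continuous_maps D Y"
  then have f: "continuous_on D f" "f ` D \<subseteq> Y" unfolding continuous_maps_def by auto
  obtain a where "homotopic_with_canon (\<lambda>_. True) D D id (\<lambda>_. a)"
    using \<open>contractible D\<close> unfolding contractible_def by blast
  then have "homotopic_with_canon (\<lambda>_. True) D D (\<lambda>_. a) id" by (rule homotopic_with_symD)
  then obtain G where G: "continuous_on ({0..1::real} \<times> D) G" "G ` ({0..1} \<times> D) \<subseteq> D"
    "\<And>x. G (0, x) = a" "\<And>x. G (1, x) = x"
    unfolding homotopic_with_def by (auto simp: image_subset_iff_funcset)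
  have aD: "a \<in> D" using G(2,3) \<open>D \<noteq> {}\<close> by force
  show "approximable_by_regular_maps X D Y f"
    unfolding approximable_by_regular_maps_def
  proof (intro allI impI)
    fix \<U> assume "openin (compact_open_topology D Y) \<U> \<and> f \<in> \<U>"
    then have \<U>: "openin (compact_open_topology D Y) \<U>" "f \<in> \<U>" by auto
    obtain K \<delta> where K: "compact K" "K \<subseteq> D" and "0 < \<delta>"
      and near: "\<And>h. h \<in> continuous_maps D Y \<Longrightarrow> \<forall>x\<in>K. dist (f x) (h x) \<le> \<delta> \<Longrightarrow> h \<in> \<U>"
      by (rule compact_open_topology_uniform_neighbourhood[OF \<U>]) (rule that)
    have GD: "G p \<in> D" if "p \<in> {0..1} \<times> K" for p
      using G(2) K(2) that by blast
    have "continuous_on ({0..1} \<times> K) (\<lambda>p. f (G p))"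
      using K(2) GD by (intro continuous_on_compose2[OF f(1)] continuous_on_subset[OF G(1)]) auto
    moreover have "(\<lambda>p. f (G p)) ` ({0..1} \<times> K) \<subseteq> Y" using GD f(2) by blast
    moreover have "regular_map X Y (\<lambda>_. f a)"
      using f(2) aD by (intro regular_map_polynomial) auto
    ultimately obtain h where h: "regular_map X Y h" "\<forall>x\<in>K. dist (f (G (1, x))) (h x) \<le> \<delta>"
      using homotopic_to_regular_imp_approximable[OF assms(1,3) K(1) _ _ _ _ _ \<open>0 < \<delta>\<close>,
          where X = X and H = "\<lambda>p. f (G p)" and g = "\<lambda>_. f a"] K(2) \<open>D \<subseteq> X\<close> G(3) by fastforce
    have "restrict h D \<in> continuous_maps D Y"
      using h(1) \<open>D \<subseteq> X\<close> continuous_on_subset[OF regular_map_continuous_on[OF h(1)]]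
      unfolding continuous_maps_def regular_map_def by (auto simp: subset_iff cong: continuous_on_cong)
    then have "restrict h D \<in> \<U>"
      using h(2) G(4) K(2) by (intro near) auto
    then show "\<exists>g. regular_map X Y g \<and> restrict g D \<in> \<U>" using h(1) by blast
  qed
qed

end
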